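(* Let $A$ be an abelian group, let $k\ge 1$ and $n\ge 0$ be integers, and let $\nu$ be an $A$-valued type $n$ invariant of pure braids with $k$ strands. Then there exists a $\mathbb{Z}$-linear map $\omega:\mathcal{VPT}\to A$ from the $\mathbb{Z}$-module of virtual pure tangle diagrams with $k$ strands such that $\omega(D)=0$ for every virtual pure tangle diagram $D$ with more than $n$ crossings, and $\nu(B)=\omega(s(B))$ for every pure braid diagram $B$ with $k$ strands.
   Context: A pure braid diagram with $k$ strands is an ordinary diagram of a braid on $k$ strands whose underlying permutation is the identity; $\nu(B)$ denotes the value of $\nu$ on the pure braid represented by $B$. An $A$-valued invariant $\nu$ of pure braids is extended to singular pure braids (with finitely many transverse double points) by $\nu(\text{double point})=\nu(\text{positive crossing})-\nu(\text{negative crossing})$ at each double point; $\nu$ is of type $n$ if this extension vanishes on all singular pure braids with more than $n$ double points. A virtual pure tangle diagram with $k$ strands is a finite set of (real) crossings, each positive or negative with its four endpoints (incoming and outgoing over-strand, incoming and outgoing under-strand), together with a pairing telling how endpoints are connected to each other and to the ends of the $k$ strands, so that the result consists of exactly $k$ numbered strands and no closed components. Equivalently: a finite set $X$ of crossings, a sign for each crossing, and a distribution of the $2|X|$ passages (one over-passage and one under-passage for each crossing) among the $k$ strands with a linear order of the passages on each strand; diagrams are taken up to bijections preserving these data. Planar realizability is not required, and additional ("virtual") intersections are not counted as crossings. Every pure braid diagram with $k$ strands determines a virtual pure tangle diagram with the same crossings. $\mathcal{VPT}$ is the $\mathbb{Z}$-module of formal linear combinations of virtual pure tangle diagrams with $k$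 strands. A subdiagram of a virtual diagram $D$ is obtained by choosing a subset of the crossings and keeping only those, with connections passing through the deleted crossings (induced signs and orders). The $\mathbb{Z}$-linear map $s:\mathcal{VPT}\to\mathcal{VPT}$ sends a diagram to the sum of all its subdiagrams (one summand for each subset of its crossings). For a pure braid diagram $B$, $s(B)$ denotes $s$ of the associated virtual diagram. *)

theory Defs
  imports "HOL-Library.Poly_Mapping" "HOL-Combinatorics.Transposition"
begin

section \<open>Braid diagrams and pure braids\<close>

text \<open>
  A braid diagram is read upwards, one crossing at a time.  The letter \<open>(i, e)\<close> is a crossing
  between the positions \<open>i\<close> and \<open>i + 1\<close> (positions are numbered from 0), positive if and only if
  \<open>e\<close> holds.  Since both strands point upwards, the strand that goes over in a positive crossing is
  the one entering at position \<open>i\<close>, and in a negative crossing the one entering at \<open>i + 1\<close>.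
\<close>

type_synonym braid_word = "(nat \<times> bool) list"

definition braid_diagram :: "nat \<Rightarrow> braid_word \<Rightarrow> bool" where
  "braid_diagram k w \<longleftrightarrow> (\<forall>(i, e) \<in> set w. Suc i < k)"

text \<open>
  \<open>strand_at is j\<close> is the strand (named by its initial position) found at position \<open>j\<close> after
  crossings at the positions listed in \<open>is\<close>.
\<close>

definition strand_at :: "nat list \<Rightarrow> nat \<Rightarrow> nat" where
  "strand_at is = fold (\<lambda>i \<sigma>. \<sigma> \<circ> transpose i (Suc i)) is id"

definition pure_braid_diagram :: "nat \<Rightarrow> braid_word \<Rightarrow> bool" where
  "pure_braid_diagram k w \<longleftrightarrow>
     braid_diagram k w \<and> (\<forall>j<k. strand_at (map fst w) j = j)"

text \<open>
  Equality of braids: planar isotopy exchanging distant crossings, and the second and third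
  Reidemeister moves.  The third move for other choices of signs follows from the one stated
  together with the second move.
\<close>

inductive braid_equiv :: "nat \<Rightarrow> braid_word \<Rightarrow> braid_word \<Rightarrow> bool" for k where
  braid_refl: "braid_diagram k u \<Longrightarrow> braid_equiv k u u"
| braid_sym: "braid_equiv k u v \<Longrightarrow> braid_equiv k v u"
| braid_trans: "braid_equiv k u v \<Longrightarrow> braid_equiv k v w \<Longrightarrow> braid_equiv k u w"
| braid_far: "braid_diagram k (u @ [(i, d), (j, e)] @ v) \<Longrightarrow> Suc i < j \<Longrightarrow>
    braid_equiv k (u @ [(i, d), (j, e)] @ v) (u @ [(j, e), (i, d)] @ v)"
| braid_R2: "braid_diagram k (u @ [(i, e), (i, \<not> e)] @ v) \<Longrightarrow>
    braid_equiv k (u @ [(i, e), (i, \<not> e)] @ v) (u @ v)"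
| braid_R3: "braid_diagram k (u @ [(i, True), (Suc i, True), (i, True)] @ v) \<Longrightarrow>
    braid_equiv k (u @ [(i, True), (Suc i, True), (i, True)] @ v)
      (u @ [(Suc i, True), (i, True), (Suc i, True)] @ v)"

type_synonym braid = "braid_word set"

definition braid_of :: "nat \<Rightarrow> braid_word \<Rightarrow> braid" where
  "braid_of k w = {w'. braid_equiv k w w'}"

section \<open>Singular pure braids and finite type invariants\<close>

datatype singular_letter = Crossing nat bool | Double_Point nat

primrec letter_pos :: "singular_letter \<Rightarrow> nat" where
  "letter_pos (Crossing i e) = i"
| "letter_pos (Double_Point i) = i"

definition singular_pure_braid_diagram :: "nat \<Rightarrow> singular_letter list \<Rightarrow> bool" where
  "singular_pure_braid_diagram k w \<longleftrightarrow>
     (\<forall>x \<in> set w. Suc (letter_pos x) < k) \<and> (\<forall>j<k. strand_at (map letter_pos w) j = j)"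

fun is_double_point :: "singular_letter \<Rightarrow> bool" where
  "is_double_point (Crossing i e) = False"
| "is_double_point (Double_Point i) = True"

text \<open>
  \<open>resolve f w\<close> extends a function \<open>f\<close> of braid diagrams to singular diagrams by
  (double point) = (positive crossing) - (negative crossing).
\<close>

fun resolve :: "(braid_word \<Rightarrow> 'a::ab_group_add) \<Rightarrow> singular_letter list \<Rightarrow> 'a" where
  "resolve f [] = f []"
| "resolve f (Crossing i e # w) = resolve (\<lambda>u. f ((i, e) # u)) w"
| "resolve f (Double_Point i # w) =
     resolve (\<lambda>u. f ((i, True) # u)) w - resolve (\<lambda>u. f ((i, False) # u)) w"

text \<open>
  An invariant of pure braids is a function \<open>\<nu>\<close> on equivalence classes of diagrams; only its values
  on the classes \<open>braid_of k w\<close> with \<open>w\<close> a pure braid diagram on \<open>k\<close> strands matter.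
\<close>

definition finite_type :: "nat \<Rightarrow> nat \<Rightarrow> (braid \<Rightarrow> 'a::ab_group_add) \<Rightarrow> bool" where
  "finite_type k n \<nu> \<longleftrightarrow>
     (\<forall>w. singular_pure_braid_diagram k w \<and> n < length (filter is_double_point w) \<longrightarrow>
        resolve (\<lambda>u. \<nu> (braid_of k u)) w = 0)"

section \<open>Virtual pure tangle diagrams\<close>

text \<open>
  A concrete diagram has natural numbers as names of its crossings.  Each strand lists its passages
  in order; \<open>(c, True)\<close> is the over-passage and \<open>(c, False)\<close> the under-passage of crossing \<open>c\<close>.
  The signs of names that are not crossings are irrelevant.
\<close>

datatype concrete_diagram = Concrete
  (crossings: "nat set") (positive: "nat \<Rightarrow> bool") (strands: "(nat \<times> bool) list list")

definition well_formed :: "concrete_diagram \<Rightarrow> bool" where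
  "well_formed D \<longleftrightarrow> finite (crossings D) \<and> distinct (concat (strands D)) \<and>
     set (concat (strands D)) = crossings D \<times> UNIV"

definition diagram_iso :: "concrete_diagram \<Rightarrow> concrete_diagram \<Rightarrow> bool" where
  "diagram_iso D E \<longleftrightarrow> well_formed D \<and> well_formed E \<and>
     (\<exists>f. bij_betw f (crossings D) (crossings E) \<and>
          (\<forall>c \<in> crossings D. positive E (f c) = positive D c) \<and>
          strands E = map (map (map_prod f id)) (strands D))"

lemma diagram_iso_refl: "well_formed D \<Longrightarrow> diagram_iso D D"
  unfolding diagram_iso_def by (auto intro!: exI[of _ id] simp: prod.map_id0)

lemma strands_names:
  assumes "well_formed D" "xs \<in> set (strands D)" "p \<in> set xs"
  shows "fst p \<in> crossings D"
proof -
  have "p \<in> set (concat (strands D))" using assms(2,3) by auto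
  then have "p \<in> crossings D \<times> UNIV" using assms(1) unfolding well_formed_def by blast
  then show ?thesis by (simp add: mem_Times_iff)
qed

lemma diagram_iso_sym:
  assumes "diagram_iso D E" shows "diagram_iso E D"
proof -
  from assms obtain f where wf: "well_formed D" "well_formed E"
    and f: "bij_betw f (crossings D) (crossings E)"
    and sg: "\<forall>c \<in> crossings D. positive E (f c) = positive D c"
    and st: "strands E = map (map (map_prod f id)) (strands D)"
    unfolding diagram_iso_def by blast
  define g where "g = inv_into (crossings D) f"
  have g: "bij_betw g (crossings E) (crossings D)"
    unfolding g_def by (rule bij_betw_inv_into[OF f])
  have gf: "g (f c) = c" if "c \<in> crossings D" for c
    unfolding g_def using f that by (simp add: bij_betw_inv_into_left)
  have fg: "f (g c) = c" if "c \<in> crossings E" for c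
    unfolding g_def using f that by (simp add: bij_betw_inv_into_right)
  have "map (map (map_prod g id)) (strands E) = map (map id) (strands D)"
  proof -
    have "map (map_prod g id) (map (map_prod f id) xs) = map id xs" if "xs \<in> set (strands D)" for xs
      unfolding map_map
      by (intro map_cong refl) (simp add: prod_eq_iff gf strands_names[OF wf(1) that])
    then show ?thesis unfolding st map_map by (intro map_cong refl) simp
  qed
  moreover have "\<forall>c \<in> crossings E. positive D (g c) = positive E c"
    using sg fg bij_betw_apply[OF g] by metis
  ultimately show ?thesis unfolding diagram_iso_def using wf g
    by (intro conjI exI[of _ g]) auto
qed

lemma diagram_iso_trans:
  assumes "diagram_iso D E" "diagram_iso E F" shows "diagram_iso D F"
proof -
  from assms obtain f g where wf: "well_formed D" "well_formed F"
    and f: "bij_betw f (crossings D) (crossings E)"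
      "\<forall>c \<in> crossings D. positive E (f c) = positive D c"
      "strands E = map (map (map_prod f id)) (strands D)"
    and g: "bij_betw g (crossings E) (crossings F)"
      "\<forall>c \<in> crossings E. positive F (g c) = positive E c"
      "strands F = map (map (map_prod g id)) (strands E)"
    unfolding diagram_iso_def by blast
  have "bij_betw (g \<circ> f) (crossings D) (crossings F)"
    using f(1) g(1) by (rule bij_betw_trans)
  moreover have "\<forall>c \<in> crossings D. positive F ((g \<circ> f) c) = positive D c"
    using f g by (auto simp: bij_betw_apply)
  moreover have "strands F = map (map (map_prod (g \<circ> f) id)) (strands D)"
    using f(3) g(3) by (simp add: map_prod.comp)
  ultimately show ?thesis using wf unfolding diagram_iso_def by blast
qed

quotient_type virtual_diagram = concrete_diagram / partial: diagram_iso
proof (rule part_equivpI)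
  have "diagram_iso (Concrete {} (\<lambda>_. True) []) (Concrete {} (\<lambda>_. True) [])"
    by (rule diagram_iso_refl) (simp add: well_formed_def)
  then show "\<exists>D. diagram_iso D D" ..
qed (auto intro: sympI transpI diagram_iso_sym diagram_iso_trans)

lift_definition n_strands :: "virtual_diagram \<Rightarrow> nat" is "\<lambda>D. length (strands D)"
  by (auto simp: diagram_iso_def)

lift_definition n_crossings :: "virtual_diagram \<Rightarrow> nat" is "\<lambda>D. card (crossings D)"
  by (auto simp: diagram_iso_def bij_betw_same_card)

definition subdiagram :: "concrete_diagram \<Rightarrow> nat set \<Rightarrow> concrete_diagram" where
  "subdiagram D Y = Concrete Y (positive D) (map (filter (\<lambda>p. fst p \<in> Y)) (strands D))"

lemma well_formed_subdiagram:
  assumes "well_formed D" "Y \<subseteq> crossings D"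
  shows "well_formed (subdiagram D Y)"
proof -
  have "concat (map (filter P) xss) = filter P (concat xss)"
    for P :: "nat \<times> bool \<Rightarrow> bool" and xss
    by (simp add: filter_concat)
  then show ?thesis using assms
    by (auto simp: well_formed_def subdiagram_def finite_subset simp del: set_concat)
qed

lemma diagram_iso_subdiagram:
  assumes "well_formed D" "well_formed E" "bij_betw f (crossings D) (crossings E)"
    and sg: "\<forall>c \<in> crossings D. positive E (f c) = positive D c"
    and st: "strands E = map (map (map_prod f id)) (strands D)"
    and Y: "Y \<subseteq> crossings D"
  shows "diagram_iso (subdiagram D Y) (subdiagram E (f ` Y))"
proof -
  have inj: "inj_on f (crossings D)" and sub: "f ` Y \<subseteq> crossings E"
    using assms(3) Y by (auto simp: bij_betw_def)
  have mem: "f c \<in> f ` Y \<longleftrightarrow> c \<in> Y" if "c \<in> crossings D" for c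
    using inj_on_image_mem_iff[OF inj that Y] .
  have "map (filter (\<lambda>p. fst p \<in> f ` Y)) (strands E) =
      map (map (map_prod f id)) (map (filter (\<lambda>p. fst p \<in> Y)) (strands D))"
  proof -
    have "filter (\<lambda>p. fst p \<in> f ` Y) (map (map_prod f id) xs) =
        map (map_prod f id) (filter (\<lambda>p. fst p \<in> Y) xs)" if "xs \<in> set (strands D)" for xs
    proof -
      have "filter (\<lambda>p. f (fst p) \<in> f ` Y) xs = filter (\<lambda>p. fst p \<in> Y) xs"
        by (rule filter_cong[OF refl]) (simp add: mem strands_names[OF assms(1) that])
      then show ?thesis by (simp add: filter_map comp_def)
    qed
    then show ?thesis unfolding st map_map by (intro map_cong refl) simp
  qed
  then show ?thesis unfolding diagram_iso_def
    using well_formed_subdiagram[OF assms(1) Y] well_formed_subdiagram[OF assms(2) sub]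
      sg Y inj_on_subset[OF inj Y]
    by (intro conjI exI[of _ f]) (auto simp: subdiagram_def bij_betw_def)
qed

lift_definition subdiagram_sum :: "virtual_diagram \<Rightarrow> (virtual_diagram \<Rightarrow>\<^sub>0 int)"
  is "\<lambda>D. \<Sum>Y \<in> Pow (crossings D). frag_of (abs_virtual_diagram (subdiagram D Y))"
proof -
  fix D E assume "diagram_iso D E"
  then obtain f where wf: "well_formed D" "well_formed E"
    and f: "bij_betw f (crossings D) (crossings E)"
      "\<forall>c \<in> crossings D. positive E (f c) = positive D c"
      "strands E = map (map (map_prod f id)) (strands D)"
    unfolding diagram_iso_def by blast
  let ?v = "\<lambda>D Y. frag_of (abs_virtual_diagram (subdiagram D Y))"
  have "(\<Sum>Y \<in> Pow (crossings D). ?v D Y) = (\<Sum>Y \<in> Pow (crossings D). ?v E (f ` Y))"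
    using diagram_iso_subdiagram[OF wf f]
    by (intro sum.cong refl arg_cong[of _ _ frag_of])
      (auto intro: Quotient_rel_abs[OF Quotient_virtual_diagram])
  also have "\<dots> = (\<Sum>Y \<in> Pow (crossings E). ?v E Y)"
    by (rule sum.reindex_bij_betw[OF bij_betw_Pow[OF f(1)]])
  finally show "(\<Sum>Y \<in> Pow (crossings D). ?v D Y) = (\<Sum>Y \<in> Pow (crossings E). ?v E Y)" .
qed

section \<open>The module of virtual pure tangle diagrams\<close>

definition virtual_diagrams :: "nat \<Rightarrow> virtual_diagram set" where
  "virtual_diagrams k = {D. n_strands D = k}"

definition VPT :: "nat \<Rightarrow> (virtual_diagram \<Rightarrow>\<^sub>0 int) set" where
  "VPT k = {x. Poly_Mapping.keys x \<subseteq> virtual_diagrams k}"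

definition s_map :: "(virtual_diagram \<Rightarrow>\<^sub>0 int) \<Rightarrow> (virtual_diagram \<Rightarrow>\<^sub>0 int)" where
  "s_map = frag_extend subdiagram_sum"

lemma s_map_VPT:
  assumes "x \<in> VPT k" shows "s_map x \<in> VPT k"
proof -
  have *: "Poly_Mapping.keys (subdiagram_sum D) \<subseteq> virtual_diagrams (n_strands D)" for D
  proof (transfer, rule order_trans[OF keys_sum], rule UN_least)
    fix D Y assume "diagram_iso D D" "Y \<in> Pow (crossings D)"
    then have "diagram_iso (subdiagram D Y) (subdiagram D Y)"
      by (intro diagram_iso_refl well_formed_subdiagram) (auto simp: diagram_iso_def)
    then show "Poly_Mapping.keys (frag_of (abs_virtual_diagram (subdiagram D Y)))
        \<subseteq> virtual_diagrams (length (strands D))"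
      by (simp add: virtual_diagrams_def n_strands.abs_eq) (simp add: subdiagram_def)
  qed
  then show ?thesis using assms keys_frag_extend[of subdiagram_sum x]
    unfolding VPT_def s_map_def virtual_diagrams_def by fastforce
qed

definition int_scale :: "int \<Rightarrow> 'a::ab_group_add \<Rightarrow> 'a" where
  "int_scale m a = (if 0 \<le> m then (\<Sum>_<nat m. a) else - (\<Sum>_<nat (- m). a))"

definition int_linear_on ::
    "(virtual_diagram \<Rightarrow>\<^sub>0 int) set \<Rightarrow> ((virtual_diagram \<Rightarrow>\<^sub>0 int) \<Rightarrow> 'a::ab_group_add) \<Rightarrow> bool" where
  "int_linear_on M \<omega> \<longleftrightarrow>
     (\<forall>x \<in> M. \<forall>y \<in> M. \<omega> (x + y) = \<omega> x + \<omega> y) \<and>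
     (\<forall>m. \<forall>x \<in> M. \<omega> (frag_cmul m x) = int_scale m (\<omega> x))"

section \<open>The virtual diagram of a pure braid diagram\<close>

text \<open>
  The crossings are named by their indices in the word.  By the convention for letters, the
  strand entering the crossing \<open>(i, e)\<close> at position \<open>i\<close> passes over if and only if \<open>e\<close> holds.
\<close>

definition passages :: "braid_word \<Rightarrow> nat \<Rightarrow> nat \<Rightarrow> (nat \<times> bool) list" where
  "passages w a m = (case w ! m of (i, e) \<Rightarrow>
     (if strand_at (map fst (take m w)) i = a then [(m, e)] else []) @
     (if strand_at (map fst (take m w)) (Suc i) = a then [(m, \<not> e)] else []))"

definition concrete_of_braid :: "nat \<Rightarrow> braid_word \<Rightarrow> concrete_diagram" where
  "concrete_of_braid k w = Concrete {..<length w} (\<lambda>m. snd (w ! m))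
     (map (\<lambda>a. concat (map (passages w a) [0..<length w])) [0..<k])"

definition virtual_of_braid :: "nat \<Rightarrow> braid_word \<Rightarrow> virtual_diagram" where
  "virtual_of_braid k w = abs_virtual_diagram (concrete_of_braid k w)"

lemma strand_at_less:
  assumes "\<forall>i \<in> set is. Suc i < k"
  shows "strand_at is j < k \<longleftrightarrow> j < k"
proof -
  have "fold (\<lambda>i \<sigma>. \<sigma> \<circ> transpose i (Suc i)) is \<tau> j < k \<longleftrightarrow> j < k"
    if "\<forall>j. \<tau> j < k \<longleftrightarrow> j < k" for \<tau> :: "nat \<Rightarrow> nat"
    using assms that by (induction "is" arbitrary: \<tau>) (auto simp: transpose_def)
  then show ?thesis by (simp add: strand_at_def)
qed

lemma distinct_concat_map:
  assumes "distinct xs" "\<And>x. x \<in> set xs \<Longrightarrow> distinct (f x)"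
    and "\<And>x y. x \<in> set xs \<Longrightarrow> y \<in> set xs \<Longrightarrow> x \<noteq> y \<Longrightarrow> set (f x) \<inter> set (f y) = {}"
  shows "distinct (concat (map f xs))"
  using assms
proof (induction xs)
  case (Cons x xs)
  have "distinct (concat (map f xs))"
    using Cons.prems by (intro Cons.IH) auto
  moreover have "set (f x) \<inter> set (concat (map f xs)) = {}"
    using Cons.prems(1) Cons.prems(3)[of x] by fastforce
  ultimately show ?case using Cons.prems(2)[of x] by simp
qed simp

lemma well_formed_concrete_of_braid:
  assumes "braid_diagram k w"
  shows "well_formed (concrete_of_braid k w)"
proof -
  let ?\<sigma> = "\<lambda>m. strand_at (map fst (take m w))"
  let ?i = "\<lambda>m. fst (w ! m)" and ?e = "\<lambda>m. snd (w ! m)"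
  have mem: "p \<in> set (passages w a m) \<longleftrightarrow> fst p = m \<and>
      (?\<sigma> m (?i m) = a \<and> snd p = ?e m \<or> ?\<sigma> m (Suc (?i m)) = a \<and> snd p = (\<not> ?e m))" for p a m
    by (cases p; cases "w ! m") (auto simp: passages_def)
  have dist: "distinct (passages w a m)" for a m
    by (auto simp: passages_def split: prod.splits)
  have lt: "?\<sigma> m (?i m) < k \<and> ?\<sigma> m (Suc (?i m)) < k" if "m < length w" for m
  proof -
    have "Suc (?i m) < k" using assms nth_mem[OF that] by (auto simp: braid_diagram_def)
    moreover have "\<forall>i \<in> set (map fst (take m w)). Suc i < k"
      using assms by (auto simp: braid_diagram_def dest!: in_set_takeD)
    ultimately show ?thesis by (simp add: strand_at_less)
  qed
  have dist': "distinct (concat (map (passages w a) [0..<length w]))" for a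
    by (rule distinct_concat_map) (auto simp: dist mem)
  have "distinct (concat (strands (concrete_of_braid k w)))"
    unfolding concrete_of_braid_def concrete_diagram.sel
  proof (rule distinct_concat_map)
    fix a b :: nat assume "a \<noteq> b"
    then show "set (concat (map (passages w a) [0..<length w])) \<inter>
        set (concat (map (passages w b) [0..<length w])) = {}"
      by (auto simp: mem)
  qed (simp_all only: dist' distinct_upt)
  moreover have "set (concat (strands (concrete_of_braid k w))) = {..<length w} \<times> UNIV"
  proof (intro subset_antisym subsetI)
    fix p assume "p \<in> set (concat (strands (concrete_of_braid k w)))"
    then show "p \<in> {..<length w} \<times> UNIV" by (auto simp: concrete_of_braid_def mem mem_Times_iff)
  next
    fix p :: "nat \<times> bool" assume p: "p \<in> {..<length w} \<times> UNIV"
    define a where "a = (if snd p = ?e (fst p) then ?\<sigma> (fst p) (?i (fst p))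
      else ?\<sigma> (fst p) (Suc (?i (fst p))))"
    have "fst p < length w" using p by auto
    then have "a < k" using lt by (simp add: a_def)
    moreover have "p \<in> set (passages w a (fst p))" by (simp add: mem a_def)
    ultimately show "p \<in> set (concat (strands (concrete_of_braid k w)))"
      using \<open>fst p < length w\<close> by (simp add: concrete_of_braid_def)
        (meson atLeastLessThan_iff le0)
  qed
  ultimately show ?thesis by (simp add: well_formed_def concrete_of_braid_def)
qed

lemma virtual_of_braid:
  assumes "braid_diagram k w"
  shows "virtual_of_braid k w \<in> virtual_diagrams k" "n_crossings (virtual_of_braid k w) = length w"
proof -
  have iso: "diagram_iso (concrete_of_braid k w) (concrete_of_braid k w)"
    using assms by (intro diagram_iso_refl well_formed_concrete_of_braid)
  show "virtual_of_braid k w \<in> virtual_diagrams k"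
    using iso unfolding virtual_diagrams_def virtual_of_braid_def
    by (simp add: n_strands.abs_eq concrete_of_braid_def)
  show "n_crossings (virtual_of_braid k w) = length w"
    using iso unfolding virtual_of_braid_def
    by (simp add: n_crossings.abs_eq concrete_of_braid_def)
qed

end

theory Submission
  imports Defs
begin

text \<open>
  Combing expresses a pure braid as a product of pure braids, one for each strand \<open>l\<close>: the loop
  that the strand \<open>l\<close> describes around the strands \<open>0, \<dots>, l - 1\<close> is a product of Wirtinger
  generators, one for each of its under-passages.  This product is computed from the Gauss diagram
  alone, so it makes sense for virtual diagrams with acyclic Gauss diagram, and extends \<open>\<nu>\<close> to
  them (not as an invariant of virtual tangles).  Every crossing \<open>c\<close> contributes to the product
  through conjugated clasps, and deleting \<open>c\<close> amounts to changing one crossing in each of these.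
  Hence alternating sums of the extended \<open>\<nu>\<close> over the subdiagrams of a diagram with more than \<open>n\<close>
  crossings are sums of values on singular braids with more than \<open>n\<close> double points.  They vanish,
  and Moebius inversion yields \<open>\<omega>\<close>.
\<close>

section \<open>Braids as a group\<close>

text \<open>The obstacle is that deleting crossings from a braid diagram in general leaves a diagram
  of no braid, so \<open>\<nu>\<close> has no value on the summands of \<open>s_map\<close> and must
  first be given one. Pulling the last strand over all others makes its over-passages free, which is
  why only under-passages leave factors in its loop. A meridian is built from those met at the
  earlier under-passages of its strand; acyclicity makes this recursion well-founded. A diagram
  fixes only a partial order of its crossings, so the value must not depend on the linear order in
  which they are processed. Conjugation copies earlier clasps into later ones, so one crossing
  \<open>c\<close> may govern many letters of the combed braid. Changing all of them at once is not
  a single double point; the difference is therefore telescoped letter by letter, each term having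
  one double point for \<open>c\<close>. Purity of these singular braids is automatic, because
  crossing changes leave the underlying permutation alone.\<close>

typedef 'a bijection = "{f :: 'a \<Rightarrow> 'a. bij f}"
  morphisms apply_bijection Bijection
  by (rule exI[of _ id]) simp

setup_lifting type_definition_bijection

text \<open>Composition is written as a sum because \<open>group_add\<close> does not require
  commutativity. For braids the summands follow the word, read upwards.\<close>

instantiation bijection :: (type) group_add
begin

lift_definition zero_bijection :: "'a bijection" is id by simp
lift_definition plus_bijection :: "'a bijection \<Rightarrow> 'a bijection \<Rightarrow> 'a bijection" is "(\<circ>)"
  by (rule bij_comp)
lift_definition uminus_bijection :: "'a bijection \<Rightarrow> 'a bijection" is inv
  by (rule bij_imp_bij_inv)
definition minus_bijection :: "'a bijection \<Rightarrow> 'a bijection \<Rightarrow> 'a bijection" where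
  "minus_bijection f g = f + - g"

instance
proof
  fix f g h :: "'a bijection"
  show "f + g + h = f + (g + h)" by transfer (simp add: comp_assoc)
  show "0 + f = f" "f + 0 = f" by (transfer, simp)+
  show "- f + f = 0" by transfer (simp add: bij_is_inj)
  show "f + - g = f - g" by (simp add: minus_bijection_def)
qed

end

section \<open>The left regular action of braids on sets of words\<close>

lemma braid_diagram_simps [simp]:
  "braid_diagram k []"
  "braid_diagram k ((i, e) # w) \<longleftrightarrow> Suc i < k \<and> braid_diagram k w"
  "braid_diagram k (u @ v) \<longleftrightarrow> braid_diagram k u \<and> braid_diagram k v"
  by (auto simp: braid_diagram_def)

lemma braid_equiv_diagrams:
  "braid_equiv k u v \<Longrightarrow> braid_diagram k u \<and> braid_diagram k v"
  by (induction rule: braid_equiv.induct) auto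

lemma braid_equiv_context:
  "braid_equiv k u v \<Longrightarrow> braid_diagram k x \<Longrightarrow> braid_diagram k y \<Longrightarrow>
    braid_equiv k (x @ u @ y) (x @ v @ y)"
proof (induction rule: braid_equiv.induct)
  case (braid_far u i d j e v)
  then show ?case using braid_equiv.braid_far[of k "x @ u" i d j e "v @ y"] by simp
next
  case (braid_R2 u i e v)
  then show ?case using braid_equiv.braid_R2[of k "x @ u" i e "v @ y"] by simp
next
  case (braid_R3 u i v)
  then show ?case using braid_equiv.braid_R3[of k "x @ u" i "v @ y"] by simp
qed (auto intro: braid_equiv.intros)

lemma braid_equiv_append:
  assumes "braid_equiv k u u'" "braid_equiv k v v'"
  shows "braid_equiv k (u @ v) (u' @ v')"
  using braid_equiv_context[OF assms(1), of "[]" v] braid_equiv_context[OF assms(2), of u' "[]"]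
    braid_equiv_diagrams[OF assms(1)] braid_equiv_diagrams[OF assms(2)]
  by (auto intro: braid_trans)

definition saturated :: "nat \<Rightarrow> braid \<Rightarrow> bool" where
  "saturated k S \<longleftrightarrow> S = {v. \<exists>w\<in>S. braid_equiv k w v}"

text \<open>
  Sets that are not unions of classes are fixed, so that the generators act bijectively on the
  whole type; thus no quotient type depending on \<open>k\<close> is needed.
\<close>

definition left_mult :: "nat \<Rightarrow> braid_word \<Rightarrow> braid \<Rightarrow> braid" where
  "left_mult k u S = (if saturated k S then {v. \<exists>w\<in>S. braid_equiv k (u @ w) v} else S)"

lemma saturated_diagram: "saturated k S \<Longrightarrow> w \<in> S \<Longrightarrow> braid_diagram k w"
  unfolding saturated_def using braid_equiv_diagrams by blast

lemma saturated_left_mult: "saturated k (left_mult k u S) \<longleftrightarrow> saturated k S"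
proof (cases "saturated k S")
  case True
  have "v \<in> left_mult k u S \<longleftrightarrow> (\<exists>w\<in>left_mult k u S. braid_equiv k w v)" for v
  proof
    assume v: "v \<in> left_mult k u S"
    then have "braid_equiv k v v"
      using True unfolding left_mult_def by (auto dest!: braid_equiv_diagrams intro: braid_refl)
    then show "\<exists>w\<in>left_mult k u S. braid_equiv k w v" using v by blast
  qed (use True in \<open>auto simp: left_mult_def intro: braid_trans\<close>)
  then have "saturated k (left_mult k u S)" unfolding saturated_def by blast
  then show ?thesis using True by simp
qed (simp add: left_mult_def)

lemma left_mult_append:
  assumes "braid_diagram k u" "braid_diagram k v"
  shows "left_mult k u \<circ> left_mult k v = left_mult k (u @ v)"
proof
  fix S
  show "(left_mult k u \<circ> left_mult k v) S = left_mult k (u @ v) S"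
  proof (cases "saturated k S")
    case True
    then have sat: "saturated k (left_mult k v S)" by (simp add: saturated_left_mult)
    have "(\<exists>w\<in>left_mult k v S. braid_equiv k (u @ w) x) \<longleftrightarrow> (\<exists>w\<in>S. braid_equiv k (u @ v @ w) x)" for x
    proof
      assume "\<exists>w\<in>left_mult k v S. braid_equiv k (u @ w) x"
      then obtain w w' where "w' \<in> S" "braid_equiv k (v @ w') w" "braid_equiv k (u @ w) x"
        using True by (auto simp: left_mult_def)
      moreover then have "braid_equiv k (u @ v @ w') (u @ w)"
        using assms(1) by (intro braid_equiv_append braid_refl)
      ultimately show "\<exists>w\<in>S. braid_equiv k (u @ v @ w) x" by (blast intro: braid_trans)
    next
      assume "\<exists>w\<in>S. braid_equiv k (u @ v @ w) x"
      then obtain w where w: "w \<in> S" "braid_equiv k (u @ v @ w) x" by blast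
      then have "v @ w \<in> left_mult k v S"
        using True assms(2) by (auto simp: left_mult_def dest: saturated_diagram
            intro!: bexI[of _ w] braid_refl)
      then show "\<exists>w\<in>left_mult k v S. braid_equiv k (u @ w) x" using w(2) by blast
    qed
    then show ?thesis using True sat unfolding comp_def left_mult_def[of k u] left_mult_def[of k "u @ v"]
      by simp
  qed (simp add: left_mult_def)
qed

lemma left_mult_Nil: "left_mult k [] = id"
  by (rule ext) (auto simp: left_mult_def saturated_def)

lemma left_mult_cong:
  assumes "braid_equiv k u v" shows "left_mult k u = left_mult k v"
proof -
  have "braid_equiv k (u @ w) x \<longleftrightarrow> braid_equiv k (v @ w) x" if "braid_diagram k w" for w x
    using braid_equiv_append[OF assms braid_refl[OF that]] by (blast intro: braid_trans braid_sym)
  then show ?thesis by (intro ext) (auto simp: left_mult_def dest: saturated_diagram)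
qed

lemma left_mult_inverse:
  assumes "Suc i < k"
  shows "left_mult k [(i, e)] \<circ> left_mult k [(i, \<not> e)] = id"
proof -
  have "braid_equiv k [(i, e), (i, \<not> e)] []"
    using braid_R2[of k "[]" i e "[]"] assms by simp
  then show ?thesis
    using assms by (simp add: left_mult_append left_mult_cong left_mult_Nil)
qed

lemma bij_left_mult: "Suc i < k \<Longrightarrow> bij (left_mult k [(i, e)])"
  using left_mult_inverse[of i k e] left_mult_inverse[of i k "\<not> e"] by (auto intro: o_bij)

text \<open>Meaningful only for \<open>Suc i < k\<close>: otherwise \<open>left_mult\<close> sends
  every saturated set to the empty set and is not a bijection.\<close>

definition braid_generator :: "nat \<Rightarrow> nat \<Rightarrow> braid bijection" where
  "braid_generator k i = Bijection (left_mult k [(i, True)])"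

definition evaluate :: "(nat \<Rightarrow> 'g::group_add) \<Rightarrow> braid_word \<Rightarrow> 'g" where
  "evaluate s w = sum_list (map (\<lambda>(i, e). if e then s i else - s i) w)"

lemma evaluate_simps [simp]:
  "evaluate s [] = 0"
  "evaluate s ((i, e) # w) = (if e then s i else - s i) + evaluate s w"
  "evaluate s (u @ v) = evaluate s u + evaluate s v"
  by (simp_all add: evaluate_def)

lemma apply_evaluate_generator:
  assumes "braid_diagram k w"
  shows "apply_bijection (evaluate (braid_generator k) w) = left_mult k w"
  using assms
proof (induction w)
  case Nil
  then show ?case by (simp add: zero_bijection.rep_eq left_mult_Nil)
next
  case (Cons x w)
  obtain i e where x: "x = (i, e)" by force
  then have i: "Suc i < k" and w: "braid_diagram k w" using Cons.prems by auto
  have T: "apply_bijection (braid_generator k i) = left_mult k [(i, True)]"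
    using bij_left_mult[OF i] by (simp add: braid_generator_def Bijection_inverse)
  have F: "inv (left_mult k [(i, True)]) = left_mult k [(i, False)]"
    using left_mult_inverse[OF i, of True] left_mult_inverse[OF i, of False]
    by (intro inv_unique_comp) simp_all
  show ?case
    using Cons.IH[OF w] left_mult_append[of k "[(i, e)]" w] i w T F
    by (cases e) (simp_all add: x plus_bijection.rep_eq uminus_bijection.rep_eq)
qed

text \<open>Acting on the class of the trivial braid recovers the class of a word from its group
  element. This is how \<open>\<nu>\<close> is later read off from elements of the group.\<close>

lemma apply_evaluate_braid_of:
  assumes "braid_diagram k w"
  shows "apply_bijection (evaluate (braid_generator k) w) (braid_of k []) = braid_of k w"
proof -
  have sat: "saturated k (braid_of k [])"
    by (auto simp: saturated_def braid_of_def intro: braid_trans) (metis braid_equiv_diagrams braid_refl)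
  have "(\<exists>u\<in>braid_of k []. braid_equiv k (w @ u) v) \<longleftrightarrow> braid_equiv k w v" for v
  proof
    assume "\<exists>u\<in>braid_of k []. braid_equiv k (w @ u) v"
    then show "braid_equiv k w v"
      using braid_equiv_append[OF braid_refl[OF assms]] by (fastforce simp: braid_of_def intro: braid_trans)
  next
    assume "braid_equiv k w v"
    then show "\<exists>u\<in>braid_of k []. braid_equiv k (w @ u) v"
      by (intro bexI[of _ "[]"]) (auto simp: braid_of_def intro: braid_refl)
  qed
  then show ?thesis
    using sat by (simp add: apply_evaluate_generator[OF assms] left_mult_def braid_of_def[of k w])
qed

section \<open>Combing\<close>

text \<open>Combing needs nothing about braids but these relations, so it is carried out in an
  arbitrary group, away from words and classes.\<close>

locale braid_relations =
  fixes k :: nat and s :: "nat \<Rightarrow> 'g::group_add"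
  assumes far: "Suc i < j \<Longrightarrow> Suc j < k \<Longrightarrow> s i + s j = s j + s i"
    and braid: "Suc (Suc i) < k \<Longrightarrow> s i + s (Suc i) + s i = s (Suc i) + s i + s (Suc i)"

lemma braid_relations_generator: "braid_relations k (braid_generator k)"
proof
  have eq: "evaluate (braid_generator k) u = evaluate (braid_generator k) v" if "braid_equiv k u v" for u v
    using left_mult_cong[OF that] braid_equiv_diagrams[OF that]
    by (metis apply_bijection_inject apply_evaluate_generator)
  show "braid_generator k i + braid_generator k j = braid_generator k j + braid_generator k i"
    if "Suc i < j" "Suc j < k" for i j
    using eq[OF braid_far[of k "[]" i True j True "[]"]] that by simp
  show "braid_generator k i + braid_generator k (Suc i) + braid_generator k i =
      braid_generator k (Suc i) + braid_generator k i + braid_generator k (Suc i)"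
    if "Suc (Suc i) < k" for i
    using eq[OF braid_R3[of k "[]" i "[]"]] that by (simp add: add.assoc)
qed

text \<open>Strand passing over, strand passing under, and whether the crossing is positive.\<close>

type_synonym gauss_letter = "nat \<times> nat \<times> bool"

section \<open>Strands and Gauss letters of a braid word\<close>

definition gauss_letter_at :: "braid_word \<Rightarrow> nat \<Rightarrow> gauss_letter" where
  "gauss_letter_at w m = (case w ! m of (i, e) \<Rightarrow>
     let \<sigma> = strand_at (map fst (take m w))
     in if e then (\<sigma> i, \<sigma> (Suc i), True) else (\<sigma> (Suc i), \<sigma> i, False))"

definition gauss_letters :: "braid_word \<Rightarrow> gauss_letter list" where
  "gauss_letters w = map (gauss_letter_at w) [0..<length w]"

lemma strand_at_Nil [simp]: "strand_at [] = id"
  by (simp add: strand_at_def)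

lemma strand_at_snoc [simp]: "strand_at (xs @ [i]) = strand_at xs \<circ> transpose i (Suc i)"
  by (simp add: strand_at_def)

lemma strand_at_append: "strand_at (xs @ ys) = strand_at xs \<circ> strand_at ys"
proof (induction ys rule: rev_induct)
  case (snoc y ys)
  then show ?case unfolding append_assoc[symmetric] strand_at_snoc by (simp add: comp_assoc)
qed simp

lemma inj_strand_at: "inj (strand_at xs)"
  by (induction xs rule: rev_induct) (simp_all add: inj_compose del: comp_apply)

lemma gauss_letters_Nil [simp]: "gauss_letters [] = []"
  by (simp add: gauss_letters_def)

lemma gauss_letters_snoc [simp]:
  "gauss_letters (w @ [(i, e)]) = gauss_letters w @
     [if e then (strand_at (map fst w) i, strand_at (map fst w) (Suc i), True)
      else (strand_at (map fst w) (Suc i), strand_at (map fst w) i, False)]"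
proof -
  have "gauss_letter_at (w @ [(i, e)]) m = gauss_letter_at w m" if "m < length w" for m
    using that by (simp add: gauss_letter_at_def nth_append)
  then have "map (gauss_letter_at (w @ [(i, e)])) [0..<length w] = gauss_letters w"
    by (simp add: gauss_letters_def)
  moreover have "gauss_letter_at (w @ [(i, e)]) (length w) =
      (if e then (strand_at (map fst w) i, strand_at (map fst w) (Suc i), True)
      else (strand_at (map fst w) (Suc i), strand_at (map fst w) i, False))"
    by (simp add: gauss_letter_at_def Let_def)
  ultimately show ?thesis by (simp add: gauss_letters_def)
qed

lemma strand_at_diagram_less:
  "braid_diagram k w \<Longrightarrow> strand_at (map fst w) j < k \<longleftrightarrow> j < k"
  by (rule strand_at_less) (auto simp: braid_diagram_def)

section \<open>Moving group elements past each other\<close>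

lemma semicommute_minus:
  fixes a b x :: "'g::group_add"
  assumes "x + b = a + x" shows "- x + a = b + - x"
proof -
  have "a = x + b - x" using assms by (simp add: eq_diff_eq)
  then show ?thesis by (simp add: add.assoc del: add_uminus_conv_diff add: diff_conv_add_uminus)
qed

lemma minus_semicommute:
  fixes a b x :: "'g::group_add"
  assumes "a + x = x + b" shows "- a + x = x + - b"
proof -
  have "a = x + b - x" using assms by (simp add: eq_diff_eq)
  then show ?thesis by (simp add: add.assoc minus_add del: add_uminus_conv_diff add: diff_conv_add_uminus)
qed

lemma add_commute_minus:
  fixes a x :: "'g::group_add"
  assumes "x + a = a + x" shows "x + - a = - a + x"
  using minus_semicommute[of a x a] assms by simp

text \<open>\<open>x\<close> becomes \<open>y\<close> on crossing the conjugator \<open>t\<close>,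
  passes the core \<open>c\<close>, and turns back into \<open>x\<close> on leaving.\<close>

lemma conjugate_commute:
  fixes c t x y :: "'g::group_add"
  assumes "x + t = t + y" "y + c = c + y"
  shows "x + (t + c + - t) = (t + c + - t) + x"
proof -
  have x: "x = t + y + - t" using assms(1) by (simp add: eq_diff_eq)
  have "x + (t + c + - t) = t + (y + c) + - t"
    unfolding x by (simp add: add.assoc del: add_uminus_conv_diff)
  also have "\<dots> = (t + c + - t) + x"
    unfolding x assms(2) by (simp add: add.assoc del: add_uminus_conv_diff)
  finally show ?thesis .
qed

section \<open>Loops and the Artin action\<close>

context braid_relations
begin

text \<open>The strand at position \<open>l\<close> moves over all other strands to position \<open>q\<close>.\<close>

definition slide :: "nat \<Rightarrow> nat \<Rightarrow> 'g" where
  "slide l q = sum_list (map (\<lambda>i. - s i) (rev [q..<l]))"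

lemma slide_same [simp]: "slide l l = 0"
  by (simp add: slide_def)

lemma slide_step: "q < l \<Longrightarrow> slide l q = slide l (Suc q) + - s q"
  by (simp add: slide_def upt_conv_Cons)

lemma slide_far:
  assumes "q \<le> l" "Suc i < q" "l < k"
  shows "s i + slide l q = slide l q + s i"
  using assms
proof (induction q rule: inc_induct)
  case (step q)
  have "s i + - s q = - s q + s i"
    using step by (intro add_commute_minus far) auto
  moreover have "s i + slide l (Suc q) = slide l (Suc q) + s i"
    using step by simp
  ultimately show ?case
    unfolding slide_step[OF step.hyps(2)] by (metis add.assoc)
qed simp

text \<open>The sliding strand lies above everything, so a crossing between two strands that it
  passes can be pulled through (third Reidemeister move). The slide pushes these strands one
  position to the right, hence the shifted index.\<close>

lemma slide_shift:
  assumes "q \<le> i" "Suc i < l" "l < k"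
  shows "s i + slide l q = slide l q + s (Suc i)"
  using assms(1)
proof (induction q rule: inc_induct)
  case base
  have *: "s i + (- s (Suc i) + - s i) = - s (Suc i) + - s i + s (Suc i)"
  proof -
    have "s (Suc i) = s (Suc i) + s i + s (Suc i) + (- s (Suc i) + - s i)"
      by (simp add: add.assoc del: add_uminus_conv_diff)
    also have "\<dots> = s i + s (Suc i) + s i + (- s (Suc i) + - s i)"
      using braid[of i] assms by simp
    finally have "- s (Suc i) + - s i + s (Suc i) =
        - s (Suc i) + - s i + (s i + s (Suc i) + s i + (- s (Suc i) + - s i))"
      by simp
    then show ?thesis by (simp add: add.assoc del: add_uminus_conv_diff)
  qed
  have **: "slide l i = slide l (Suc (Suc i)) + (- s (Suc i) + - s i)"
    using assms by (simp add: slide_step[of i] slide_step[of "Suc i"] add.assoc del: add_uminus_conv_diff)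
  show ?case
    using slide_far[of "Suc (Suc i)" l i] assms * unfolding ** by (metis Suc_leI add.assoc lessI)
next
  case (step q)
  have "- s q + s (Suc i) = s (Suc i) + - s q"
    using step assms by (intro minus_semicommute far) auto
  moreover have "slide l q = slide l (Suc q) + - s q"
    using step assms by (intro slide_step) simp
  ultimately show ?case
    using step.IH by (simp only: add.assoc) (simp only: add.assoc[symmetric])
qed

text \<open>
  The strand at position \<open>l\<close> reaches the strand at position \<open>p\<close> by passing over everything,
  encircles it, and returns.
\<close>

definition loop :: "nat \<Rightarrow> nat \<Rightarrow> 'g" where
  "loop l p = slide l (Suc p) + (s p + s p) + - slide l (Suc p)"

lemma loop_far:
  assumes "p < l" "Suc i < l" "l < k" "p \<noteq> i" "p \<noteq> Suc i"
  shows "s i + loop l p = loop l p + s i"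
proof (cases "Suc i < p")
  case True
  have "s i + s p = s p + s i" using far[of i p] assms True by simp
  then have "s i + (s p + s p) = s p + s p + s i" by (metis add.assoc)
  moreover have "s i + slide l (Suc p) = slide l (Suc p) + s i"
    using slide_far[of "Suc p" l i] assms True by simp
  ultimately show ?thesis unfolding loop_def by (intro conjugate_commute)
next
  case False
  then have "p < i" using assms by simp
  have "s (Suc i) + s p = s p + s (Suc i)" using far[of p "Suc i"] assms \<open>p < i\<close> by simp
  then have "s (Suc i) + (s p + s p) = s p + s p + s (Suc i)" by (metis add.assoc)
  moreover have "s i + slide l (Suc p) = slide l (Suc p) + s (Suc i)"
    using slide_shift[of "Suc p" i l] assms \<open>p < i\<close> by simp
  ultimately show ?thesis unfolding loop_def by (intro conjugate_commute)
qed

text \<open>Above a positive crossing the strand at \<open>Suc i\<close> is the over-strand, which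
  entered at \<open>i\<close>; its meridian is unchanged. Together with \<open>loop_under\<close>
  this is the Artin action of a generator on the free generators.\<close>

lemma loop_over:
  assumes "Suc i < l" "l < k"
  shows "s i + loop l (Suc i) = loop l i + s i"
proof -
  let ?T = "slide l (Suc (Suc i))" and ?a = "s i" and ?b = "s (Suc i)"
  have T: "slide l (Suc i) = ?T + - ?b" using assms slide_step by blast
  have br: "?a + ?b + ?a = ?b + ?a + ?b" using braid[of i] assms by simp
  have "?b + (?a + ?b + ?b) = (?b + ?a + ?b) + ?b" by (simp add: add.assoc)
  also have "\<dots> = (?a + ?b + ?a) + ?b" by (simp only: br)
  also have "\<dots> = ?a + (?b + ?a + ?b)" by (simp only: add.assoc)
  also have "\<dots> = ?a + (?a + ?b + ?a)" by (simp only: br)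
  also have "\<dots> = ?a + ?a + ?b + ?a" by (simp only: add.assoc)
  finally have "?b + (?a + ?b + ?b) = ?a + ?a + ?b + ?a" .
  then have "- ?b + (?b + (?a + ?b + ?b)) = - ?b + (?a + ?a + ?b + ?a)" by simp
  then have *: "?a + (?b + ?b) = - ?b + (?a + ?a) + ?b + ?a"
    by (simp add: add.assoc del: add_uminus_conv_diff)
  have c: "?a + ?T = ?T + ?a" using slide_far[of "Suc (Suc i)" l i] assms by simp
  have c': "?a + - ?T = - ?T + ?a" using c by (rule add_commute_minus)
  have "?a + loop l (Suc i) = (?a + ?T) + (?b + ?b + - ?T)"
    unfolding loop_def by (simp add: add.assoc del: add_uminus_conv_diff)
  also have "\<dots> = ?T + (?a + (?b + ?b)) + - ?T"
    unfolding c by (simp add: add.assoc del: add_uminus_conv_diff)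
  finally have "?a + loop l (Suc i) = ?T + (?a + (?b + ?b)) + - ?T" .
  also have "\<dots> = ?T + (- ?b + (?a + ?a) + ?b) + - ?T + ?a"
    unfolding * using c' by (simp add: add.assoc del: add_uminus_conv_diff)
  finally show ?thesis
    unfolding loop_def T by (simp add: add.assoc minus_add del: add_uminus_conv_diff)
qed

text \<open>The product \<open>loop l (Suc i) + loop l i\<close> encircles both strands of the
  crossing and therefore commutes with \<open>s i\<close>; with \<open>loop_over\<close> this
  determines the action on the other loop.\<close>

lemma loop_under:
  assumes "Suc i < l" "l < k"
  shows "s i + loop l i = - loop l i + loop l (Suc i) + loop l i + s i"
proof -
  let ?T = "slide l (Suc (Suc i))" and ?a = "s i" and ?b = "s (Suc i)"
  have T: "slide l (Suc i) = ?T + - ?b" using assms slide_step by blast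
  have br: "?a + ?b + ?a = ?b + ?a + ?b" using braid[of i] assms by simp
  have *: "?a + (?b + ?a + ?a + ?b) = ?b + ?a + ?a + ?b + ?a"
  proof -
    have "?a + (?b + ?a + ?a + ?b) = (?a + ?b + ?a) + ?a + ?b" by (simp add: add.assoc)
    also have "\<dots> = (?b + ?a + ?b) + ?a + ?b" by (simp only: br)
    also have "\<dots> = ?b + ?a + (?b + ?a + ?b)" by (simp only: add.assoc)
    also have "\<dots> = ?b + ?a + (?a + ?b + ?a)" by (simp only: br)
    also have "\<dots> = ?b + ?a + ?a + ?b + ?a" by (simp only: add.assoc)
    finally show ?thesis .
  qed
  have c: "?a + ?T = ?T + ?a" using slide_far[of "Suc (Suc i)" l i] assms by simp
  have X: "loop l (Suc i) + loop l i = ?T + (?b + ?a + ?a + ?b) + - ?T"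
    unfolding loop_def T by (simp add: add.assoc minus_add del: add_uminus_conv_diff)
  have "?a + (loop l (Suc i) + loop l i) = loop l (Suc i) + loop l i + ?a"
    unfolding X using c * by (rule conjugate_commute)
  moreover have "?a + (loop l (Suc i) + loop l i) = loop l i + (?a + loop l i)"
    unfolding add.assoc[symmetric] loop_over[OF assms] ..
  ultimately have "loop l i + (?a + loop l i) = loop l (Suc i) + loop l i + ?a" by simp
  then have "- loop l i + (loop l i + (?a + loop l i)) = - loop l i + (loop l (Suc i) + loop l i + ?a)"
    by simp
  then show ?thesis by (simp add: add.assoc del: add_uminus_conv_diff)
qed

text \<open>
  Wirtinger generators of the braid formed by the strands \<open>0, \<dots>, l - 1\<close>: \<open>loop l a\<close> is the
  meridian of the strand \<open>a\<close> at the bottom, and \<open>g a\<close> is the product of the meridians of the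
  strands under which \<open>a\<close> has passed so far.
\<close>

definition meridian :: "nat \<Rightarrow> (nat \<Rightarrow> 'g) \<Rightarrow> nat \<Rightarrow> 'g" where
  "meridian l g a = - g a + loop l a + g a"

text \<open>The bound on \<open>b\<close> is not strict: the entry at \<open>l\<close> itself
  collects the loop described by the strand \<open>l\<close>. Letters with \<open>a = l\<close> are
  skipped, as over-passages of \<open>l\<close> are absorbed by the slide.\<close>

definition comb_step :: "nat \<Rightarrow> gauss_letter \<Rightarrow> (nat \<Rightarrow> 'g) \<Rightarrow> (nat \<Rightarrow> 'g)" where
  "comb_step l = (\<lambda>(a, b, e) g. if a < l \<and> b \<le> l
     then g(b := g b + (if e then meridian l g a else - meridian l g a)) else g)"

definition longitude :: "nat \<Rightarrow> gauss_letter list \<Rightarrow> nat \<Rightarrow> 'g" where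
  "longitude l t = fold (comb_step l) t (\<lambda>_. 0)"

text \<open>The combed normal form of a pure braid: the first factor becomes trivial when the strand
  \<open>l\<close> is forgotten, the second does not involve that strand.\<close>

primrec combed :: "nat \<Rightarrow> gauss_letter list \<Rightarrow> 'g" where
  "combed 0 t = 0"
| "combed (Suc l) t = longitude l t l + combed l t"

lemma longitude_Nil [simp]: "longitude l [] = (\<lambda>_. 0)"
  by (simp add: longitude_def)

lemma longitude_snoc: "longitude l (t @ [x]) = comb_step l x (longitude l t)"
  by (simp add: longitude_def)

text \<open>A loop around the strand arriving at \<open>p\<close> is pulled down through
  \<open>B\<close>. At each under-passage it is conjugated by the meridian of the over-strand, as in
  the Wirtinger presentation, and at the bottom it is a conjugate of the loop at the initial
  position of that strand.\<close>

lemma wirtinger: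
  assumes "braid_diagram l B" "l < k" "p < l"
  shows "evaluate s B + loop l p =
    meridian l (longitude l (gauss_letters B)) (strand_at (map fst B) p) + evaluate s B"
  using assms(1,3)
proof (induction B arbitrary: p rule: rev_induct)
  case Nil
  then show ?case by (simp add: meridian_def)
next
  case (snoc x B)
  obtain i e where x: "x = (i, e)" by force
  have i: "Suc i < l" and B: "braid_diagram l B" using snoc.prems by (auto simp: x)
  define \<sigma> E g where "\<sigma> = strand_at (map fst B)" and "E = evaluate s B"
    and "g = longitude l (gauss_letters B)"
  define m where "m p = meridian l g (\<sigma> p)" for p
  have IH: "m p = E + loop l p + - E" if "p < l" for p
    using snoc.IH[OF B that] by (simp add: \<sigma>_def E_def g_def m_def)
  have less: "\<sigma> i < l" "\<sigma> (Suc i) < l"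
    using strand_at_diagram_less[OF B] i by (auto simp: \<sigma>_def)
  have inj: "\<sigma> p = \<sigma> q \<longleftrightarrow> p = q" for p q
    using inj_strand_at by (auto simp: \<sigma>_def inj_eq)
  define g' where "g' = longitude l (gauss_letters (B @ [x]))"
  have g': "g' = (if e then g(\<sigma> (Suc i) := g (\<sigma> (Suc i)) + m i)
      else g(\<sigma> i := g (\<sigma> i) + - m (Suc i)))"
    using less by (simp add: g'_def x longitude_snoc comb_step_def g_def m_def \<sigma>_def)
  have \<sigma>': "strand_at (map fst (B @ [x])) p = \<sigma> (transpose i (Suc i) p)"
    by (simp add: x \<sigma>_def)
  note assoc = add.assoc minus_add
  have over: "s i + loop l (Suc i) = loop l i + s i" using loop_over[OF i assms(2)] .
  have under: "s i + loop l i = - loop l i + loop l (Suc i) + loop l i + s i"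
    using loop_under[OF i assms(2)] .
  have over': "- s i + loop l i = loop l (Suc i) + - s i"
    using over by (rule semicommute_minus)
  \<comment> \<open>The under-strand at a negative crossing: the relation is first proved for
    \<open>s i\<close> with the conjugate on the other side, then \<open>s i\<close> is
    inverted.\<close>
  have "s i + (loop l (Suc i) + loop l i + - loop l (Suc i)) =
      (s i + loop l (Suc i)) + loop l i + - loop l (Suc i)"
    by (simp only: add.assoc)
  also have "\<dots> = loop l i + (s i + loop l i) + - loop l (Suc i)"
    unfolding over by (simp only: add.assoc)
  also have "\<dots> = loop l (Suc i) + (loop l i + s i) + - loop l (Suc i)"
    unfolding under by (simp add: assoc del: add_uminus_conv_diff)
  also have "\<dots> = loop l (Suc i) + s i"
    unfolding over[symmetric] by (simp add: assoc del: add_uminus_conv_diff)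
  finally have under': "- s i + loop l (Suc i) = loop l (Suc i) + loop l i + - loop l (Suc i) + - s i"
    by (rule semicommute_minus)
  have "E + ((if e then s i else - s i) + loop l p) =
      meridian l g' (\<sigma> (transpose i (Suc i) p)) + (E + (if e then s i else - s i))"
  proof (cases "p = i \<or> p = Suc i")
    case False
    then have "s i + loop l p = loop l p + s i"
      using loop_far[OF snoc.prems(2) i assms(2)] by simp
    then have "(if e then s i else - s i) + loop l p = loop l p + (if e then s i else - s i)"
      using minus_semicommute by auto
    moreover have "meridian l g' (\<sigma> (transpose i (Suc i) p)) = m p"
      using False by (simp add: g' meridian_def m_def inj)
    ultimately show ?thesis
      using IH[OF snoc.prems(2)] by (simp add: assoc del: add_uminus_conv_diff)
  next
    case True
    show ?thesis
    \<comment> \<open>This is the position at which the over-strand leaves the crossing.\<close>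
    proof (cases "p = (if e then Suc i else i)")
      case True
      then have "meridian l g' (\<sigma> (transpose i (Suc i) p)) = m (if e then i else Suc i)"
        by (simp add: g' meridian_def m_def inj)
      then show ?thesis
        using True IH i over over' by (simp add: assoc del: add_uminus_conv_diff)
    next
      case False
      then have "meridian l g' (\<sigma> (transpose i (Suc i) p)) =
          (if e then - m i + m (Suc i) + m i else m (Suc i) + m i + - m (Suc i))"
        using \<open>p = i \<or> p = Suc i\<close>
        by (auto simp: g' meridian_def m_def inj assoc simp del: add_uminus_conv_diff)
      then show ?thesis
        using False \<open>p = i \<or> p = Suc i\<close> IH i under under'
        by (auto simp: assoc simp del: add_uminus_conv_diff)
    qed
  qed
  then show ?case
    unfolding \<sigma>' g'_def[symmetric] by (simp add: x E_def add.assoc)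
qed

end

section \<open>Splitting off the last strand\<close>

definition letters_below :: "nat \<Rightarrow> gauss_letter list \<Rightarrow> gauss_letter list" where
  "letters_below l = filter (\<lambda>(a, b, e). a < l \<and> b < l)"

lemma letters_below_simps [simp]:
  "letters_below l [] = []"
  "letters_below l (t @ [(a, b, e)]) = letters_below l t @ (if a < l \<and> b < l then [(a, b, e)] else [])"
  by (simp_all add: letters_below_def)

context braid_relations
begin

lemma comb_step_restrict:
  assumes "\<And>a. a < l \<Longrightarrow> g a = h a" "a < l"
  shows "comb_step l (x, y, e) g a =
    (if x < l \<and> y < l then comb_step l (x, y, e) h a else h a)"
  using assms by (auto simp: comb_step_def meridian_def)

text \<open>Only entries of over-strands \<open>a < l\<close> are ever read, so what is stored at
  \<open>l\<close> never flows back into the entries below \<open>l\<close>.\<close>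

lemma longitude_restrict:
  assumes "a < l"
  shows "longitude l (letters_below l t) a = longitude l t a"
  using assms
proof (induction t arbitrary: a rule: rev_induct)
  case (snoc x t)
  obtain u v e where "x = (u, v, e)" by (metis surj_pair)
  then show ?case
    using snoc.IH snoc.prems comb_step_restrict[of l "longitude l t"
        "longitude l (letters_below l t)" a u v e]
    by (simp add: longitude_snoc)
qed simp

lemma longitude_filter_below:
  assumes "j < l"
  shows "longitude j (letters_below l t) = longitude j t"
  using assms by (induction t rule: rev_induct) (auto simp: longitude_snoc comb_step_def)

lemma combed_filter:
  "j \<le> l \<Longrightarrow> combed j (letters_below l t) = combed j t"
  by (induction j) (auto simp: longitude_filter_below)

text \<open>Here \<open>q\<close> is the current position of the strand \<open>l\<close>, and
  \<open>B'\<close> is \<open>B\<close> without that strand. The invariant splits \<open>B\<close>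
  into the loop of \<open>l\<close> at the bottom, the remaining braid, and a slide of
  \<open>l\<close> over everything to its position \<open>q\<close>.\<close>

lemma combing:
  assumes "braid_diagram (Suc l) B" "l < k"
  obtains B' q where "q \<le> l" "strand_at (map fst B) q = l" "braid_diagram l B'"
    "gauss_letters B' = letters_below l (gauss_letters B)"
    "\<And>p. p < l \<Longrightarrow> strand_at (map fst B') p = strand_at (map fst B) (if p < q then p else Suc p)"
    "evaluate s B = longitude l (gauss_letters B) l + evaluate s B' + slide l q"
  using assms(1)
proof (induction B arbitrary: thesis rule: rev_induct)
  case Nil
  show ?case by (rule Nil(1)[of l "[]"]) simp_all
next
  case (snoc x B)
  obtain i e where x: "x = (i, e)" by force
  have i: "i < l" and B: "braid_diagram (Suc l) B" using snoc.prems by (auto simp: x)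
  define \<sigma> g where "\<sigma> = strand_at (map fst B)" and "g = longitude l (gauss_letters B)"
  obtain B' q where q: "q \<le> l" "\<sigma> q = l" and B': "braid_diagram l B'"
    and gl: "gauss_letters B' = letters_below l (gauss_letters B)"
    and st: "\<And>p. p < l \<Longrightarrow> strand_at (map fst B') p = \<sigma> (if p < q then p else Suc p)"
    and ev: "evaluate s B = g l + evaluate s B' + slide l q"
    using snoc.IH[OF _ B] unfolding \<sigma>_def g_def by blast
  have less: "\<sigma> j \<le> l \<longleftrightarrow> j \<le> l" for j
    using strand_at_diagram_less[OF B, of j] by (auto simp: \<sigma>_def)
  have inj: "\<sigma> u = \<sigma> v \<longleftrightarrow> u = v" for u v
    using inj_strand_at by (auto simp: \<sigma>_def inj_eq)
  have below: "\<sigma> j < l" if "j \<le> l" "j \<noteq> q" for j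
    using less[of j] inj[of j q] q that by simp
  have letters: "gauss_letters (B @ [x]) = gauss_letters B @
      [if e then (\<sigma> i, \<sigma> (Suc i), True) else (\<sigma> (Suc i), \<sigma> i, False)]"
    by (simp add: x \<sigma>_def)
  have long: "longitude l (gauss_letters (B @ [x])) =
      comb_step l (if e then (\<sigma> i, \<sigma> (Suc i), True) else (\<sigma> (Suc i), \<sigma> i, False)) g"
    unfolding letters by (simp add: longitude_snoc g_def)
  have strand: "strand_at (map fst (B @ [x])) = \<sigma> \<circ> transpose i (Suc i)"
    by (simp add: x \<sigma>_def)
  have eval: "evaluate s (B @ [x]) = g l + evaluate s B' + slide l q + (if e then s i else - s i)"
    using ev by (simp add: x)
  \<comment> \<open>\<open>B'\<close> has lost the letters of the strand \<open>l\<close>, but by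
    \<open>longitude_restrict\<close> its meridians are still those computed from
    \<open>g\<close>.\<close>
  have mer: "evaluate s B' + loop l p = meridian l g (strand_at (map fst B') p) + evaluate s B'"
    if "p < l" for p
    using wirtinger[OF B' assms(2) that] strand_at_diagram_less[OF B', of p] that
    by (simp add: gl longitude_restrict meridian_def g_def)
  have mer': "evaluate s B' + - loop l p = - meridian l g (strand_at (map fst B') p) + evaluate s B'"
    if "p < l" for p
    using minus_semicommute[OF mer[OF that, symmetric]] by simp
  consider "i \<noteq> q" "Suc i \<noteq> q" | "i = q" | "Suc i = q" by blast
  then show ?case
  proof cases
    case 1
    \<comment> \<open>Forgetting the strand at \<open>q\<close> lowers the positions to its right by
      one.\<close>
    define j where "j = (if i < q then i else i - 1)"
    have j: "Suc j < l" using 1 i q by (auto simp: j_def)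
    have \<sigma>: "strand_at (map fst B') j = \<sigma> i" "strand_at (map fst B') (Suc j) = \<sigma> (Suc i)"
      using st[of j] st[of "Suc j"] j 1 by (auto simp: j_def)
    have "s j + slide l q = slide l q + s i"
    proof (cases "i < q")
      case True
      then show ?thesis using slide_far[of q l i] 1 q assms(2) by (simp add: j_def)
    next
      case False
      then show ?thesis using slide_shift[of q j l] 1 j assms(2) by (simp add: j_def)
    qed
    then have sl: "(if e then s j else - s j) + slide l q = slide l q + (if e then s i else - s i)"
      using minus_semicommute by auto
    have l: "comb_step l (if e then (\<sigma> i, \<sigma> (Suc i), True) else (\<sigma> (Suc i), \<sigma> i, False)) g l = g l"
      using below[of i] below[of "Suc i"] 1 i by (auto simp: comb_step_def)
    show ?thesis
    proof (rule snoc.prems(1))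
      show "q \<le> l" "strand_at (map fst (B @ [x])) q = l" "braid_diagram l (B' @ [(j, e)])"
        unfolding strand using q 1 B' j by simp_all
      show "gauss_letters (B' @ [(j, e)]) =
          letters_below l (gauss_letters (B @ [x]))"
        unfolding letters using below[of i] below[of "Suc i"] 1 i by (simp add: gl \<sigma>)
      show "strand_at (map fst (B' @ [(j, e)])) p =
          strand_at (map fst (B @ [x])) (if p < q then p else Suc p)" if "p < l" for p
      proof (cases "i < q")
        case True
        then show ?thesis
          unfolding strand using st[OF that] \<sigma> 1 by (auto simp: transpose_def j_def)
      next
        case False
        then have "i = Suc j" "q \<le> j" using 1 by (auto simp: j_def)
        then show ?thesis
          unfolding strand using st[OF that] \<sigma> by (auto simp: transpose_def)
      qed
      show "evaluate s (B @ [x]) =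
          longitude l (gauss_letters (B @ [x])) l + evaluate s (B' @ [(j, e)]) + slide l q"
        unfolding eval long l using sl by (simp add: add.assoc del: add_uminus_conv_diff)
    qed
  next
    case 2
    have \<sigma>: "strand_at (map fst B') q = \<sigma> (Suc q)" using st[of q] 2 i by simp
    have sl: "slide l q = slide l (Suc q) + - s q" using 2 i by (intro slide_step) simp
    have a: "\<sigma> (Suc q) < l" using below[of "Suc q"] 2 i by simp
    show ?thesis
    proof (rule snoc.prems(1))
      show "Suc q \<le> l" "strand_at (map fst (B @ [x])) (Suc q) = l" "braid_diagram l B'"
        unfolding strand using q 2 B' i by simp_all
      show "gauss_letters B' = letters_below l (gauss_letters (B @ [x]))"
        unfolding letters using 2 q by (simp add: gl)
      show "strand_at (map fst B') p =
          strand_at (map fst (B @ [x])) (if p < Suc q then p else Suc p)" if "p < l" for p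
        unfolding strand using st[OF that] 2 by (auto simp: transpose_def)
      show "evaluate s (B @ [x]) =
          longitude l (gauss_letters (B @ [x])) l + evaluate s B' + slide l (Suc q)"
      proof (cases e)
        case True
        then show ?thesis
          unfolding eval long using 2 q sl
          by (simp add: comb_step_def add.assoc del: add_uminus_conv_diff)
      next
        case False
        have "longitude l (gauss_letters (B @ [x])) l = g l + - meridian l g (\<sigma> (Suc q))"
          unfolding long using False 2 q a by (simp add: comb_step_def)
        \<comment> \<open>The strand \<open>l\<close> goes under here, although the slide to
          \<open>Suc q\<close> would go over. The discrepancy is an inverse loop, which
          \<open>mer'\<close> carries down through \<open>B'\<close> to become the new factor of the
          longitude.\<close>
        moreover have "slide l q + - s q = - loop l q + slide l (Suc q)"
          unfolding loop_def sl by (simp add: add.assoc minus_add del: add_uminus_conv_diff)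
        then have "evaluate s (B @ [x]) = g l + (evaluate s B' + - loop l q) + slide l (Suc q)"
          unfolding eval using False 2 by (simp add: add.assoc del: add_uminus_conv_diff)
        ultimately show ?thesis
          using mer'[of q] 2 i \<sigma> by (simp add: add.assoc del: add_uminus_conv_diff)
      qed
    qed
  next
    case 3
    have \<sigma>: "strand_at (map fst B') i = \<sigma> i" using st[of i] 3 i by simp
    have sl: "slide l i = slide l q + - s i" using slide_step[of i l] 3 i by simp
    have a: "\<sigma> i < l" using below[of i] 3 i by simp
    show ?thesis
    proof (rule snoc.prems(1))
      show "i \<le> l" "strand_at (map fst (B @ [x])) i = l" "braid_diagram l B'"
        unfolding strand using q 3 B' i by simp_all
      show "gauss_letters B' = letters_below l (gauss_letters (B @ [x]))"
        unfolding letters using 3 q by (simp add: gl)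
      show "strand_at (map fst B') p =
          strand_at (map fst (B @ [x])) (if p < i then p else Suc p)" if "p < l" for p
        unfolding strand using st[OF that] 3 by (auto simp: transpose_def)
      show "evaluate s (B @ [x]) =
          longitude l (gauss_letters (B @ [x])) l + evaluate s B' + slide l i"
      proof (cases e)
        case False
        then show ?thesis
          unfolding eval long using 3 q sl
          by (simp add: comb_step_def add.assoc del: add_uminus_conv_diff)
      next
        case True
        have "longitude l (gauss_letters (B @ [x])) l = g l + meridian l g (\<sigma> i)"
          unfolding long using True 3 q a by (simp add: comb_step_def)
        \<comment> \<open>The mirror case: \<open>l\<close> moves left under the strand at
          \<open>i\<close>, which differs from a longer slide by a positive loop.\<close>
        moreover have "slide l q + s i = loop l i + slide l i"
          unfolding loop_def sl 3 by (simp add: add.assoc minus_add del: add_uminus_conv_diff)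
        then have "evaluate s (B @ [x]) = g l + (evaluate s B' + loop l i) + slide l i"
          unfolding eval using True 3 by (simp add: add.assoc del: add_uminus_conv_diff)
        ultimately show ?thesis
          using mer[of i] 3 i \<sigma> by (simp add: add.assoc del: add_uminus_conv_diff)
      qed
    qed
  qed
qed

text \<open>In a pure braid the strand \<open>l\<close> returns to position \<open>l\<close>, so the
  final slide is empty and the remaining braid is pure again.\<close>

theorem evaluate_pure_braid:
  assumes "pure_braid_diagram l B" "l \<le> k"
  shows "evaluate s B = combed l (gauss_letters B)"
  using assms
proof (induction l arbitrary: B)
  case 0
  then show ?case by (cases B) (auto simp: pure_braid_diagram_def)
next
  case (Suc l)
  then have B: "braid_diagram (Suc l) B" and pure: "\<And>j. j < Suc l \<Longrightarrow> strand_at (map fst B) j = j"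
    by (auto simp: pure_braid_diagram_def)
  have "l < k" using Suc.prems by simp
  obtain B' q where q: "q \<le> l" "strand_at (map fst B) q = l" and B': "braid_diagram l B'"
    and gl: "gauss_letters B' = letters_below l (gauss_letters B)"
    and st: "\<And>p. p < l \<Longrightarrow> strand_at (map fst B') p = strand_at (map fst B) (if p < q then p else Suc p)"
    and ev: "evaluate s B = longitude l (gauss_letters B) l + evaluate s B' + slide l q"
    using combing[OF B \<open>l < k\<close>] by blast
  have "q = l" using q pure[of q] by simp
  then have "pure_braid_diagram l B'"
    using B' st pure by (simp add: pure_braid_diagram_def)
  from Suc.IH[OF this] Suc.prems(2) have "evaluate s B' = combed l (gauss_letters B)"
    unfolding gl by (simp add: combed_filter)
  then show ?case using ev \<open>q = l\<close> by simp
qed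

end

section \<open>Gauss words\<close>

definition strand_passages :: "(nat \<times> gauss_letter) list \<Rightarrow> nat \<Rightarrow> (nat \<times> bool) list" where
  "strand_passages v x = concat (map (\<lambda>(c, a, b, e).
     (if a = x then [(c, True)] else []) @ (if b = x then [(c, False)] else [])) v)"

text \<open>\<open>v\<close> is a linear extension of the orders on the strands. Such a word exists
  only if these orders are jointly acyclic, and it is not unique in general.\<close>

definition represents :: "nat \<Rightarrow> (nat \<times> gauss_letter) list \<Rightarrow> concrete_diagram \<Rightarrow> bool" where
  "represents k v D \<longleftrightarrow> distinct (map fst v) \<and> crossings D = fst ` set v \<and>
     (\<forall>(c, a, b, e) \<in> set v. a < k \<and> b < k \<and> positive D c = e) \<and>
     strands D = map (strand_passages v) [0..<k]"

lemma strand_passages_simps [simp]: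
  "strand_passages [] x = []"
  "strand_passages ((c, a, b, e) # v) x = (if a = x then [(c, True)] else []) @
     (if b = x then [(c, False)] else []) @ strand_passages v x"
  "strand_passages (u @ v) x = strand_passages u x @ strand_passages v x"
  by (simp_all add: strand_passages_def)

lemma in_strand_passages:
  "(c, True) \<in> set (strand_passages v x) \<longleftrightarrow> (\<exists>b e. (c, x, b, e) \<in> set v)"
  "(c, False) \<in> set (strand_passages v x) \<longleftrightarrow> (\<exists>a e. (c, a, x, e) \<in> set v)"
  by (induction v) auto

lemma in_strand_passagesD:
  "(c, t) \<in> set (strand_passages v x) \<Longrightarrow> \<exists>a b e. (c, a, b, e) \<in> set v \<and> (a = x \<or> b = x)"
  by (cases t) (auto simp: in_strand_passages)

text \<open>Deleting letters keeps the order of the others. Hence all subdiagrams of a braid diagram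
  have Gauss words, even those that come from no braid.\<close>

lemma represents_subdiagram:
  assumes "represents k v D" "Y \<subseteq> crossings D"
  shows "represents k (filter (\<lambda>x. fst x \<in> Y) v) (subdiagram D Y)"
proof -
  have "strand_passages (filter (\<lambda>x. fst x \<in> Y) v) x =
      filter (\<lambda>p. fst p \<in> Y) (strand_passages v x)" for x
    by (induction v) auto
  moreover have "distinct (map fst (filter (\<lambda>x. fst x \<in> Y) v))"
    using assms(1) by (auto simp: represents_def distinct_map intro: inj_on_subset)
  ultimately show ?thesis
    using assms by (auto simp: represents_def subdiagram_def image_iff)
qed

lemma represents_iso:
  assumes "represents k v D" "diagram_iso D E"
  obtains v' where "represents k v' E" "map snd v' = map snd v"
proof -
  from assms(2) obtain f where f: "bij_betw f (crossings D) (crossings E)"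
    and sg: "\<forall>c \<in> crossings D. positive E (f c) = positive D c"
    and st: "strands E = map (map (map_prod f id)) (strands D)"
    unfolding diagram_iso_def by blast
  have "strand_passages (map (map_prod f id) v) x = map (map_prod f id) (strand_passages v x)" for x
    by (induction v) auto
  then have "strands E = map (strand_passages (map (map_prod f id) v)) [0..<k]"
    using assms(1) st by (simp add: represents_def)
  moreover have "distinct (map fst (map (map_prod f id) v))"
    using assms(1) f by (auto simp: represents_def bij_betw_def distinct_map comp_inj_on
        intro!: comp_inj_on[of fst _ f, unfolded comp_def])
  moreover have "crossings E = fst ` set (map (map_prod f id) v)"
    using assms(1) f by (auto simp: represents_def bij_betw_def image_image)
  moreover have "\<forall>(c, a, b, e) \<in> set (map (map_prod f id) v). a < k \<and> b < k \<and> positive E c = e"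
  proof (intro ballI, clarify)
    fix c a b e assume "(c, a, b, e) \<in> set (map (map_prod f id) v)"
    then have "(c, a, b, e) \<in> map_prod f id ` set v" by simp
    then obtain z where "(c, a, b, e) = map_prod f id z" "z \<in> set v" by (rule imageE)
    then have c': "(fst z, a, b, e) \<in> set v" "c = f (fst z)" by (cases z; simp)+
    then have "fst z \<in> crossings D" using assms(1) \<open>z \<in> set v\<close> by (simp add: represents_def)
    moreover have "a < k \<and> b < k \<and> positive D (fst z) = e"
      using assms(1) c'(1) by (auto simp: represents_def)
    ultimately show "a < k \<and> b < k \<and> positive E c = e" using sg c'(2) by simp
  qed
  ultimately have "represents k (map (map_prod f id) v) E"
    unfolding represents_def by (intro conjI)
  then show thesis by (rule that) simp
qed

lemma represents_concrete_of_braid: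
  assumes "braid_diagram k w"
  shows "represents k (map (\<lambda>m. (m, gauss_letter_at w m)) [0..<length w]) (concrete_of_braid k w)"
proof -
  define \<sigma> where "\<sigma> m = strand_at (map fst (take m w))" for m
  have less: "a < k \<and> b < k \<and> snd (w ! m) = e"
    if "m < length w" "gauss_letter_at w m = (a, b, e)" for m a b e
  proof -
    obtain i e' where w: "w ! m = (i, e')" by force
    then have "Suc i < k" using assms nth_mem[OF that(1)] by (auto simp: braid_diagram_def)
    moreover have "braid_diagram k (take m w)"
      using assms by (auto simp: braid_diagram_def dest: in_set_takeD)
    then have "\<sigma> m j < k \<longleftrightarrow> j < k" for j
      unfolding \<sigma>_def by (rule strand_at_diagram_less)
    moreover have "(a, b, e) = (if e' then (\<sigma> m i, \<sigma> m (Suc i), True) else (\<sigma> m (Suc i), \<sigma> m i, False))"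
      using that(2) by (simp add: gauss_letter_at_def Let_def w \<sigma>_def split: if_splits)
    ultimately show ?thesis by (simp add: w split: if_splits)
  qed
  have inj: "\<sigma> m i = x \<Longrightarrow> \<sigma> m j = x \<Longrightarrow> i = j" for m i j x
    using inj_strand_at by (auto simp: \<sigma>_def inj_eq)
  \<comment> \<open>One side lists the over-passage before the under-passage, the other goes by
    position; they agree because a crossing of a braid involves two different strands.\<close>
  have "(case gauss_letter_at w m of (a, b, e) \<Rightarrow>
      (if a = x then [(m, True)] else []) @ (if b = x then [(m, False)] else [])) = passages w x m" for m x
    using inj[of m "fst (w ! m)" x "Suc (fst (w ! m))"]
    by (cases "w ! m") (auto simp: passages_def gauss_letter_at_def Let_def \<sigma>_def[symmetric])
  then have "strand_passages (map (\<lambda>m. (m, gauss_letter_at w m)) [0..<length w]) x =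
      concat (map (passages w x) [0..<length w])" for x
    unfolding strand_passages_def map_map comp_def by simp
  then show ?thesis
    unfolding represents_def concrete_of_braid_def concrete_diagram.sel
    using less by (auto simp: comp_def image_image)
qed

definition same_strand :: "gauss_letter \<Rightarrow> gauss_letter \<Rightarrow> bool" where
  "same_strand x y \<longleftrightarrow> {fst x, fst (snd x)} \<inter> {fst y, fst (snd y)} \<noteq> {}"

text \<open>
  The first letter of one word can be moved to the front of the other, because the letters
  preceding it there share no strand with it.
\<close>

lemma fold_eq_if_same_passages:
  fixes f :: "gauss_letter \<Rightarrow> 's \<Rightarrow> 's"
  assumes commute: "\<And>x y. \<not> same_strand x y \<Longrightarrow> f x \<circ> f y = f y \<circ> f x"
    and "distinct (map fst v)" "distinct (map fst v')"
    and "\<And>x. strand_passages v x = strand_passages v' x"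
    and "\<And>z. z \<in> set v \<union> set v' \<Longrightarrow> snd (snd (snd z)) = pos (fst z)"
  shows "fold f (map snd v) = fold f (map snd v')"
  using assms(2-)
proof (induction v arbitrary: v')
  case Nil
  have "v' = []"
  proof (rule ccontr)
    assume "v' \<noteq> []"
    then obtain c a b e u where "v' = (c, a, b, e) # u" by (metis list.exhaust surj_pair)
    then show False using Nil(3)[of a] by simp
  qed
  then show ?case by simp
next
  case (Cons z v)
  obtain c a b e where z: "z = (c, a, b, e)" by (metis surj_pair)
  have "(c, True) \<in> set (strand_passages v' a)" "(c, False) \<in> set (strand_passages v' b)"
    using Cons.prems(3)[of a] Cons.prems(3)[of b] by (metis in_strand_passages list.set_intros(1) z)+
  then obtain a' b' e' e'' where *: "(c, a, b', e') \<in> set v'" "(c, a', b, e'') \<in> set v'"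
    by (auto simp: in_strand_passages)
  then have "b' = b" using eq_key_imp_eq_value[OF Cons.prems(2)] by blast
  moreover have "e' = e" 
    using Cons.prems(4)[of "(c, a, b', e')"] Cons.prems(4)[of z] *(1) z by simp
  ultimately have "z \<in> set v'" using *(1) z by simp
  then obtain u w where v': "v' = u @ z # w" by (blast dest: split_list)
  have u: "c \<notin> fst ` set u" using Cons.prems(2) by (auto simp: v' z)
  have disjoint: "\<not> same_strand x (a, b, e)" if x: "x \<in> set (map snd u)" for x
  proof
    assume ss: "same_strand x (a, b, e)"
    obtain c' r t e1 where c': "(c', r, t, e1) \<in> set u" "x = (r, t, e1)" using x by auto
    define y where "y = (if r = a \<or> t = a then a else b)"
    have y: "r = y \<or> t = y" "y = a \<or> y = b" using ss c' by (auto simp: same_strand_def y_def)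
    then have "strand_passages u y \<noteq> []"
      using c' in_strand_passages[of c' u y] by fastforce
    \<comment> \<open>On the strand \<open>y\<close> the first passage belongs to \<open>c\<close>
      by the order of \<open>v\<close>, but to a letter of \<open>u\<close> by the order of
      \<open>v'\<close>.\<close>
    then have "hd (strand_passages u y) \<in> set (strand_passages u y)"
      and "hd (strand_passages v' y) = hd (strand_passages u y)" by (simp_all add: v')
    moreover have "fst (hd (strand_passages v' y)) = c"
      using Cons.prems(3)[of y] y by (auto simp: z dest: sym)
    ultimately have "(c, snd (hd (strand_passages u y))) \<in> set (strand_passages u y)"
      by (metis prod.collapse)
    then have "c \<in> fst ` set u" using in_strand_passagesD by force
    then show False using u by blast
  qed
  have "f (a, b, e) \<circ> fold f (map snd u) = fold f (map snd u) \<circ> f (a, b, e)"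
    using disjoint by (intro fold_commute commute[symmetric]) simp
  moreover have "strand_passages v x = strand_passages (u @ w) x" for x
  proof (cases "x = a \<or> x = b")
    case True
    have "strand_passages u x = []"
    proof (rule ccontr)
      assume "strand_passages u x \<noteq> []"
      then obtain p t where "(p, t) \<in> set (strand_passages u x)" by (metis last_in_set surj_pair)
      then obtain r1 r2 r3 where "(p, r1, r2, r3) \<in> set u" "r1 = x \<or> r2 = x"
        using in_strand_passagesD by blast
      then show False using disjoint[of "(r1, r2, r3)"] True by (force simp: same_strand_def)
    qed
    then show ?thesis using Cons.prems(3)[of x] by (simp add: v' z)
  next
    case False
    then show ?thesis using Cons.prems(3)[of x] by (auto simp: v' z)
  qed
  then have "fold f (map snd v) = fold f (map snd (u @ w))"
    using Cons.prems(1,2,4) unfolding v' by (intro Cons.IH) auto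
  ultimately show ?case by (simp add: v' z comp_assoc)
qed

context braid_relations
begin

text \<open>Neither step writes an entry that the other reads or writes.\<close>

lemma comb_step_commute:
  "\<not> same_strand x y \<Longrightarrow> comb_step l x \<circ> comb_step l y = comb_step l y \<circ> comb_step l x"
proof (rule ext)
  fix g assume "\<not> same_strand x y"
  moreover obtain a b e where x: "x = (a, b, e)" by (metis surj_pair)
  moreover obtain a' b' e' where y: "y = (a', b', e')" by (metis surj_pair)
  ultimately have "a \<noteq> b'" "a' \<noteq> b" "b \<noteq> b'" by (auto simp: same_strand_def)
  then show "(comb_step l x \<circ> comb_step l y) g = (comb_step l y \<circ> comb_step l x) g"
    by (simp add: x y comb_step_def meridian_def fun_upd_twist[of b b'])
qed

lemma combed_unique:
  assumes "represents k v D" "represents k v' D"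
  shows "combed l (map snd v) = combed l (map snd v')"
proof -
  have same: "strand_passages v x = strand_passages v' x" for x
  proof (cases "x < k")
    case True
    then have "strand_passages v x = strands D ! x" "strand_passages v' x = strands D ! x"
      using assms by (simp_all add: represents_def)
    then show ?thesis by simp
  next
    case False
    have "strand_passages u x = []" if "represents k u D" for u
    proof (rule ccontr)
      assume "strand_passages u x \<noteq> []"
      then obtain p t where "(p, t) \<in> set (strand_passages u x)" by (metis last_in_set surj_pair)
      then show False
        using that False in_strand_passagesD[of p t u x] by (fastforce simp: represents_def)
    qed
    then show ?thesis using assms by simp
  qed
  have "fold (comb_step j) (map snd v) = fold (comb_step j) (map snd v')" for j
  proof (rule fold_eq_if_same_passages[where pos = "positive D"])
    show "comb_step j x \<circ> comb_step j y = comb_step j y \<circ> comb_step j x" if "\<not> same_strand x y" for x y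
      using comb_step_commute[OF that] .
    show "distinct (map fst v)" "distinct (map fst v')"
      using assms by (auto simp: represents_def)
    show "strand_passages v x = strand_passages v' x" for x by (rule same)
    show "snd (snd (snd z)) = positive D (fst z)" if "z \<in> set v \<union> set v'" for z
      using assms that by (cases z) (auto simp: represents_def)
  qed
  then show ?thesis by (induction l) (simp_all add: longitude_def)
qed

lemma combed_iso:
  assumes "represents k v D" "represents k v' D'" "diagram_iso D D'"
  shows "combed l (map snd v) = combed l (map snd v')"
  using represents_iso[OF assms(1,3)] combed_unique[OF _ assms(2)] by metis

end

section \<open>Alternating sums\<close>

text \<open>The Moebius transform on the lattice of finite subsets. Signs are taken by cases, as the
  values lie in an abelian group only.\<close>

definition alternating :: "('b set \<Rightarrow> 'a::ab_group_add) \<Rightarrow> 'b set \<Rightarrow> 'a" where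
  "alternating f Z = (\<Sum>Y\<in>Pow Z. if even (card (Z - Y)) then f Y else - f Y)"

lemma alternating_cong:
  "(\<And>Y. Y \<subseteq> Z \<Longrightarrow> f Y = g Y) \<Longrightarrow> alternating f Z = alternating g Z"
  unfolding alternating_def by (intro sum.cong) auto

lemma alternating_add: "alternating (\<lambda>Y. f Y + g Y) Z = alternating f Z + alternating g Z"
  unfolding alternating_def sum.distrib[symmetric] by (intro sum.cong) auto

lemma alternating_uminus: "alternating (\<lambda>Y. - f Y) Z = - alternating f Z"
  unfolding alternating_def sum_negf[symmetric] by (intro sum.cong) auto

lemma alternating_empty [simp]: "alternating f {} = f {}"
  by (simp add: alternating_def)

lemma alternating_insert:
  assumes "finite Z" "c \<notin> Z"
  shows "alternating f (insert c Z) = alternating (\<lambda>Y. f (insert c Y)) Z - alternating f Z"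
proof -
  let ?g = "\<lambda>Y. if even (card (insert c Z - Y)) then f Y else - f Y"
  have "alternating f (insert c Z) = sum ?g (Pow Z) + sum ?g (insert c ` Pow Z)"
    unfolding alternating_def Pow_insert using assms by (intro sum.union_disjoint) auto
  also have "sum ?g (Pow Z) = - alternating f Z"
    unfolding alternating_def sum_negf[symmetric]
  proof (rule sum.cong[OF refl])
    fix Y assume "Y \<in> Pow Z"
    then have "insert c Z - Y = insert c (Z - Y)" using assms by auto
    then have "card (insert c Z - Y) = Suc (card (Z - Y))" using assms by simp
    then show "?g Y = - (if even (card (Z - Y)) then f Y else - f Y)" by simp
  qed
  also have "sum ?g (insert c ` Pow Z) = (\<Sum>Y\<in>Pow Z. ?g (insert c Y))"
    by (rule sum.reindex_cong[OF _ refl refl]) (use assms in \<open>auto simp: inj_on_def\<close>)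
  also have "\<dots> = alternating (\<lambda>Y. f (insert c Y)) Z"
    unfolding alternating_def
  proof (rule sum.cong[OF refl])
    fix Y assume "Y \<in> Pow Z"
    then have "insert c Z - insert c Y = Z - Y" using assms by auto
    then show "?g (insert c Y) = (if even (card (Z - Y)) then f (insert c Y) else - f (insert c Y))"
      by simp
  qed
  finally show ?thesis by simp
qed

lemma alternating_const:
  assumes "finite Z" "Z \<noteq> {}" shows "alternating (\<lambda>_. r) Z = 0"
proof -
  obtain c Z' where "Z = insert c Z'" "c \<notin> Z'" using assms(2) by (meson all_not_in_conv mk_disjoint_insert)
  then show ?thesis using assms(1) by (simp add: alternating_insert)
qed

text \<open>Moebius inversion: by \<open>alternating_insert\<close> the subsets containing
  \<open>c\<close> contribute differences, which telescope against those without
  \<open>c\<close>.\<close>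

lemma sum_alternating:
  assumes "finite X" shows "(\<Sum>Z\<in>Pow X. alternating f Z) = f X"
  using assms
proof (induction X arbitrary: f rule: finite_induct)
  case (insert c X)
  have "(\<Sum>Z\<in>Pow (insert c X). alternating f Z) =
      (\<Sum>Z\<in>Pow X. alternating f Z) + (\<Sum>Z\<in>insert c ` Pow X. alternating f Z)"
    unfolding Pow_insert using insert.hyps by (intro sum.union_disjoint) auto
  also have "(\<Sum>Z\<in>insert c ` Pow X. alternating f Z) = (\<Sum>Z\<in>Pow X. alternating f (insert c Z))"
    by (rule sum.reindex_cong[OF _ refl refl]) (use insert.hyps in \<open>auto simp: inj_on_def\<close>)
  also have "\<dots> = (\<Sum>Z\<in>Pow X. alternating (\<lambda>Y. f (insert c Y)) Z - alternating f Z)"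
    using insert.hyps by (intro sum.cong refl alternating_insert) (auto intro: finite_subset)
  also have "\<dots> = f (insert c X) - (\<Sum>Z\<in>Pow X. alternating f Z)"
    by (simp add: sum_subtractf insert.IH)
  finally show ?case by simp
qed simp

section \<open>Labelled words\<close>

type_synonym labelled_word = "(nat \<times> bool \<times> nat option) list"

text \<open>
  A label is the name of a crossing of a Gauss word.  Restricting the Gauss word to the names in
  \<open>Y\<close> amounts to changing the crossings of the labelled word whose label is not in \<open>Y\<close>.
\<close>

definition realize :: "nat set \<Rightarrow> labelled_word \<Rightarrow> braid_word" where
  "realize Y = map (\<lambda>(i, e, c). (i, case c of None \<Rightarrow> e | Some d \<Rightarrow> (e \<longleftrightarrow> d \<in> Y)))"

lemma realize_simps [simp]:
  "realize Y [] = []"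
  "realize Y ((i, e, None) # L) = (i, e) # realize Y L"
  "realize Y ((i, e, Some d) # L) = (i, e \<longleftrightarrow> d \<in> Y) # realize Y L"
  "realize Y (L @ L') = realize Y L @ realize Y L'"
  by (simp_all add: realize_def)

lemma map_fst_realize [simp]: "map fst (realize Y L) = map fst L"
  by (auto simp: realize_def)

abbreviation singular_of :: "braid_word \<Rightarrow> singular_letter list" where
  "singular_of \<equiv> map (\<lambda>(i, e). Crossing i e)"

lemma resolve_singular_of: "resolve f (singular_of u) = f u"
  by (induction u arbitrary: f) auto

lemma resolve_Double_Point:
  "resolve f (p @ Double_Point i # w) =
    resolve f (p @ Crossing i True # w) - resolve f (p @ Crossing i False # w)"
proof (induction p arbitrary: f)
  case (Cons x p)
  then show ?case by (cases x) (simp_all add: algebra_simps)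
qed simp

definition pure_positions :: "nat \<Rightarrow> nat list \<Rightarrow> bool" where
  "pure_positions k xs \<longleftrightarrow> (\<forall>i \<in> set xs. Suc i < k) \<and> (\<forall>j<k. strand_at xs j = j)"

lemma singular_pure_braid_diagram_iff:
  "singular_pure_braid_diagram k w \<longleftrightarrow> pure_positions k (map letter_pos w)"
  by (auto simp: singular_pure_braid_diagram_def pure_positions_def)

text \<open>The prefix \<open>p\<close> has been read, \<open>L\<close> has not; names in
  \<open>Z\<close> still vary and those in \<open>C\<close> are fixed as present. A letter labelled
  by \<open>d\<close> in \<open>Z\<close> is replaced by its changed crossing, at the cost of a term
  with a double point in which \<open>d\<close> is fixed. Thus the double points and the varying
  names together always exceed \<open>n\<close>.\<close>

lemma alternating_realize_vanishes:
  fixes f :: "braid_word \<Rightarrow> 'a::ab_group_add"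
  assumes vanish: "\<And>w. singular_pure_braid_diagram k w \<Longrightarrow> n < length (filter is_double_point w) \<Longrightarrow>
      resolve f w = 0"
    and "pure_positions k (map letter_pos p @ map fst L)"
    and "finite Z" "Z \<inter> C = {}" "n < length (filter is_double_point p) + card Z"
  shows "alternating (\<lambda>Y. resolve f (p @ singular_of (realize (Y \<union> C) L))) Z = 0"
  using assms(2-)
proof (induction L arbitrary: p Z C)
  case Nil
  show ?case
  proof (cases "Z = {}")
    case True
    then show ?thesis
      using Nil vanish[of p] by (simp add: realize_def singular_pure_braid_diagram_iff)
  next
    case False
    \<comment> \<open>The word is used up while a name still varies: the summands no longer depend
      on \<open>Y\<close> and cancel.\<close>
    then show ?thesis using Nil by (simp add: realize_def alternating_const)
  qed
next
  case (Cons x L)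
  obtain i e c where x: "x = (i, e, c)" by (metis surj_pair)
  have pos: "pure_positions k (map letter_pos (p @ [y]) @ map fst L)" if "letter_pos y = i" for y
    using Cons.prems(1) that by (simp add: x)
  define h where "h = (\<lambda>q C Y. resolve f (q @ singular_of (realize (Y \<union> C) L)))"
  have IH: "alternating (h (p @ [y]) C') Z' = 0"
    if "letter_pos y = i" "finite Z'" "Z' \<inter> C' = {}"
      "n < length (filter is_double_point (p @ [y])) + card Z'" for y C' Z'
    using Cons.IH[OF pos[OF that(1)] that(2-4)] by (simp only: h_def)
  show ?case
  proof (cases "\<exists>d\<in>Z. c = Some d")
    case False
    define e' where "e' = (case c of None \<Rightarrow> e | Some d \<Rightarrow> (e \<longleftrightarrow> d \<in> C))"
    have "alternating (\<lambda>Y. resolve f (p @ singular_of (realize (Y \<union> C) (x # L)))) Z =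
        alternating (h (p @ [Crossing i e']) C) Z"
    proof (rule alternating_cong)
      fix Y assume "Y \<subseteq> Z"
      then have "(case c of None \<Rightarrow> e | Some d \<Rightarrow> (e \<longleftrightarrow> d \<in> Y \<union> C)) = e'"
        using False by (auto simp: e'_def split: option.split)
      then show "resolve f (p @ singular_of (realize (Y \<union> C) (x # L))) = h (p @ [Crossing i e']) C Y"
        by (simp add: h_def x realize_def)
    qed
    also have "\<dots> = 0" using Cons.prems by (intro IH) auto
    finally show ?thesis .
  next
    case True
    then obtain d where d: "d \<in> Z" "c = Some d" by blast
    define Z' where "Z' = Z - {d}"
    have Z: "Z = insert d Z'" "d \<notin> Z'" "finite Z'" "d \<notin> C"
      using d Cons.prems by (auto simp: Z'_def)
    let ?F = "\<lambda>Y. resolve f (p @ singular_of (realize (Y \<union> C) (x # L)))"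
    let ?N = "h (p @ [Crossing i (\<not> e)])" and ?D = "h (p @ [Double_Point i])"
    have *: "?N (insert d C) Y = ?N C (insert d Y)" for Y
      by (simp add: h_def)
    \<comment> \<open>The crossing \<open>e\<close> equals the crossing \<open>\<not> e\<close> plus
      the double point if \<open>e\<close> is positive, and minus it otherwise.\<close>
    have "alternating (\<lambda>Y. ?F (insert d Y)) Z' =
        alternating (\<lambda>Y. ?N (insert d C) Y + (if e then ?D (insert d C) Y else - ?D (insert d C) Y)) Z'"
      by (rule alternating_cong) (simp add: h_def x d(2) resolve_Double_Point)
    also have "\<dots> = alternating (?N (insert d C)) Z' +
        (if e then alternating (?D (insert d C)) Z' else - alternating (?D (insert d C)) Z')"
      by (simp add: alternating_add alternating_uminus)
    \<comment> \<open>The new double point makes up for the name \<open>d\<close>, which has moved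
      from the varying to the fixed names.\<close>
    also have "alternating (?D (insert d C)) Z' = 0"
      using Z Cons.prems by (intro IH) auto
    finally have "alternating (\<lambda>Y. ?F (insert d Y)) Z' = alternating (\<lambda>Y. ?N C (insert d Y)) Z'"
      by (simp add: *)
    moreover have "alternating ?F Z' = alternating (?N C) Z'"
    proof (rule alternating_cong)
      fix Y assume "Y \<subseteq> Z'"
      then have "d \<notin> Y \<union> C" using Z by blast
      then show "?F Y = ?N C Y" by (simp add: h_def x d(2))
    qed
    ultimately have "alternating ?F Z = alternating (?N C) Z"
      using Z by (simp add: alternating_insert)
    also have "\<dots> = 0" using Cons.prems by (intro IH) auto
    finally show ?thesis .
  qed
qed

section \<open>Combed braids as labelled words\<close>

definition inverse_word :: "labelled_word \<Rightarrow> labelled_word" where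
  "inverse_word L = rev (map (\<lambda>(i, e, c). (i, \<not> e, c)) L)"

definition slide_word :: "nat \<Rightarrow> nat \<Rightarrow> labelled_word" where
  "slide_word l q = map (\<lambda>i. (i, False, None)) (rev [q..<l])"

text \<open>Only one of the two crossings of the clasp is labelled: changing it undoes the loop.\<close>

definition loop_word :: "nat \<Rightarrow> nat \<Rightarrow> bool \<Rightarrow> nat \<Rightarrow> labelled_word" where
  "loop_word l p e c = slide_word l (Suc p) @ [(p, e, None), (p, e, Some c)] @
     inverse_word (slide_word l (Suc p))"

text \<open>The lift of \<open>comb_step\<close> to words. The conjugating copies of
  \<open>g a\<close> keep their labels, so a single name may occur at many letters.\<close>

definition comb_step_word ::
    "nat \<Rightarrow> nat \<times> gauss_letter \<Rightarrow> (nat \<Rightarrow> labelled_word) \<Rightarrow> nat \<Rightarrow> labelled_word" where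
  "comb_step_word l = (\<lambda>(c, a, b, e) g. if a < l \<and> b \<le> l
     then g(b := g b @ inverse_word (g a) @ loop_word l a e c @ g a) else g)"

definition longitude_word :: "nat \<Rightarrow> (nat \<times> gauss_letter) list \<Rightarrow> nat \<Rightarrow> labelled_word" where
  "longitude_word l v = fold (comb_step_word l) v (\<lambda>_. [])"

primrec combed_word :: "nat \<Rightarrow> (nat \<times> gauss_letter) list \<Rightarrow> labelled_word" where
  "combed_word 0 v = []"
| "combed_word (Suc l) v = longitude_word l v l @ combed_word l v"

text \<open>Inversion keeps the labels, so a crossing and its inverse are changed simultaneously and
  stay inverse to each other.\<close>

lemma evaluate_inverse_word: "evaluate s (realize Y (inverse_word L)) = - evaluate s (realize Y L)"
proof (induction L)
  case (Cons x L)
  obtain i e c where x: "x = (i, e, c)" by (metis surj_pair)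
  have "inverse_word (x # L) = inverse_word L @ [(i, \<not> e, c)]" by (simp add: inverse_word_def x)
  then show ?case using Cons.IH by (cases c) (auto simp: x minus_add simp del: add_uminus_conv_diff)
qed (simp add: inverse_word_def)

lemma strand_at_rev: "strand_at (rev xs) \<circ> strand_at xs = id"
proof (induction xs)
  case (Cons x xs)
  have x: "strand_at [x] = transpose x (Suc x)" by (simp add: strand_at_def)
  have "strand_at (rev (x # xs)) = strand_at (rev xs) \<circ> strand_at [x]"
    by (simp only: rev.simps strand_at_append)
  moreover have "strand_at (x # xs) = strand_at [x] \<circ> strand_at xs"
    using strand_at_append[of "[x]" xs] by simp
  ultimately show ?case using Cons.IH by (simp add: x fun_eq_iff)
qed simp

lemma map_fst_inverse_word: "map fst (inverse_word L) = rev (map fst L)"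
  by (simp add: inverse_word_def rev_map[symmetric] comp_def case_prod_unfold)

text \<open>The positions form a palindrome of even length. Only positions matter for purity, so
  crossing changes and double points preserve it.\<close>

lemma pure_loop_word: "strand_at (map fst (loop_word l p e c)) = id"
proof -
  define xs where "xs = map fst (slide_word l (Suc p))"
  have "map fst (loop_word l p e c) = (xs @ [p]) @ rev (xs @ [p])"
    by (simp add: loop_word_def xs_def map_fst_inverse_word)
  then show ?thesis
    using strand_at_rev[of "rev (xs @ [p])"] by (simp only: strand_at_append rev_rev_ident)
qed

lemma positions_loop_word:
  "x \<in> set (loop_word l p e c) \<Longrightarrow> p < l \<Longrightarrow> fst x < l"
  by (auto simp: loop_word_def slide_word_def inverse_word_def)

lemma longitude_word_positions:
  "x \<in> set (longitude_word l v a) \<Longrightarrow> fst x < l"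
proof (induction v arbitrary: a x rule: rev_induct)
  case (snoc z v)
  obtain c a' b e where z: "z = (c, a', b, e)" by (metis surj_pair)
  have "fst y < l" if "y \<in> set (inverse_word (longitude_word l v a'))" for y
  proof -
    have "fst y \<in> set (map fst (inverse_word (longitude_word l v a')))" using that by simp
    then show ?thesis unfolding map_fst_inverse_word using snoc.IH by auto
  qed
  moreover have "longitude_word l (v @ [z]) = comb_step_word l z (longitude_word l v)"
    by (simp add: longitude_word_def)
  ultimately show ?case
    using snoc.prems snoc.IH positions_loop_word[of x l a' e c]
    by (cases x) (auto simp: z comb_step_word_def split: if_splits)
qed (simp add: longitude_word_def)

lemma pure_longitude_word: "strand_at (map fst (longitude_word l v a)) = id"
proof (induction v arbitrary: a rule: rev_induct)
  case (snoc z v)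
  obtain c a' b e where z: "z = (c, a', b, e)" by (metis surj_pair)
  let ?g = "longitude_word l v"
  have "strand_at (map fst (inverse_word (?g a'))) = id"
    using strand_at_rev[of "map fst (?g a')"] snoc.IH
    by (simp add: map_fst_inverse_word comp_def id_def)
  moreover have "longitude_word l (v @ [z]) = comb_step_word l z ?g"
    by (simp add: longitude_word_def)
  ultimately show ?case
    using snoc.IH by (simp add: z comb_step_word_def strand_at_append pure_loop_word comp_def)
qed (simp add: longitude_word_def)

lemma pure_positions_combed_word:
  assumes "l \<le> k" shows "pure_positions k (map fst (combed_word l v))"
  using assms
proof (induction l)
  case (Suc l)
  have "Suc (fst x) < k" if "x \<in> set (longitude_word l v l)" for x
    using longitude_word_positions[OF that] Suc.prems by simp
  moreover have "strand_at (map fst (combed_word (Suc l) v)) = strand_at (map fst (combed_word l v))"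
    by (simp add: strand_at_append pure_longitude_word)
  ultimately show ?case using Suc by (auto simp: pure_positions_def)
qed (simp add: pure_positions_def)

context braid_relations
begin

lemma evaluate_loop_word:
  "evaluate s (realize Y (loop_word l p e c)) =
    (if c \<in> Y then if e then loop l p else - loop l p else 0)"
proof -
  have "evaluate s (realize Y (slide_word l q)) = slide l q" for q
    by (simp add: slide_word_def slide_def realize_def evaluate_def comp_def)
  then show ?thesis
    by (auto simp: loop_word_def evaluate_inverse_word loop_def minus_add add.assoc
        simp del: add_uminus_conv_diff)
qed

text \<open>If \<open>c\<close> is not in \<open>Y\<close>, its clasp cancels and so do the
  conjugating words around it; the step then acts as if the letter \<open>c\<close> were
  absent.\<close>

lemma evaluate_longitude_word:
  "evaluate s (realize Y (longitude_word l v a)) =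
    longitude l (map snd (filter (\<lambda>x. fst x \<in> Y) v)) a"
proof (induction v arbitrary: a rule: rev_induct)
  case (snoc z v)
  obtain c a' b e where z: "z = (c, a', b, e)" by (metis surj_pair)
  have "longitude_word l (v @ [z]) = comb_step_word l z (longitude_word l v)"
    by (simp add: longitude_word_def)
  then show ?case
    using snoc.IH
    by (auto simp: z longitude_snoc comb_step_word_def comb_step_def meridian_def
        evaluate_inverse_word evaluate_loop_word minus_add add.assoc simp del: add_uminus_conv_diff)
qed (simp add: longitude_word_def)

text \<open>All subdiagrams are thereby governed by one labelled word, which turns deletion of
  crossings into crossing changes of an honest pure braid.\<close>

lemma evaluate_combed_word:
  "evaluate s (realize Y (combed_word l v)) = combed l (map snd (filter (\<lambda>x. fst x \<in> Y) v))"
  by (induction l) (simp_all add: evaluate_longitude_word)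

end

section \<open>The formula\<close>

lemma int_scale_0 [simp]: "int_scale 0 a = 0" and int_scale_1 [simp]: "int_scale 1 a = a"
  by (simp_all add: int_scale_def)

lemma int_scale_step: "int_scale (m + 1) a = int_scale m a + a"
proof (cases "0 \<le> m")
  case True
  then have "nat (m + 1) = Suc (nat m)" by simp
  then show ?thesis using True by (simp add: int_scale_def add.commute)
next
  case False
  then have "nat (- m) = Suc (nat (- (m + 1)))" by simp
  then have "int_scale m a = - (\<Sum>_<nat (- (m + 1)). a) + - a"
    using False unfolding int_scale_def by simp
  moreover have "int_scale (m + 1) a = - (\<Sum>_<nat (- (m + 1)). a)"
    using False by (cases "m = -1") (simp_all add: int_scale_def)
  ultimately show ?thesis by simp
qed

lemma int_scale_pred: "int_scale (m - 1) a = int_scale m a - a"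
  using int_scale_step[of "m - 1" a] by simp

lemma int_scale_add: "int_scale (l + m) a = int_scale l a + int_scale m a"
proof (induction m rule: int_induct[where k = 0])
  case (step1 m)
  then show ?case using int_scale_step[of "l + m" a] int_scale_step[of m a] by (simp add: add.assoc)
next
  case (step2 m)
  then show ?case by (simp only: add_diff_eq int_scale_pred)
qed simp

lemma int_scale_add_right: "int_scale m (a + b) = int_scale m a + int_scale m b"
  by (induction m rule: int_induct[where k = 0]) (simp_all add: int_scale_step int_scale_pred)

lemma int_scale_zero_right [simp]: "int_scale m 0 = 0"
  using int_scale_add_right[of m 0 0] by simp

lemma int_scale_mult: "int_scale (l * m) a = int_scale l (int_scale m a)"
proof (induction l rule: int_induct[where k = 0])
  case (step1 l)
  then show ?case by (simp add: int_scale_step int_scale_add distrib_right)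
next
  case (step2 l)
  have "int_scale (l * m) a = int_scale ((l - 1) * m) a + int_scale m a"
    unfolding int_scale_add[symmetric] by (simp add: algebra_simps)
  then show ?case using step2 int_scale_step[of "l - 1" "int_scale m a"] by (simp add: algebra_simps)
qed simp

lemma int_scale_sum: "int_scale m (sum f X) = (\<Sum>x\<in>X. int_scale m (f x))"
  by (induction X rule: infinite_finite_induct) (simp_all add: int_scale_add_right)

definition linear_extension :: "('b \<Rightarrow> 'a::ab_group_add) \<Rightarrow> ('b \<Rightarrow>\<^sub>0 int) \<Rightarrow> 'a" where
  "linear_extension w x = (\<Sum>D\<in>Poly_Mapping.keys x. int_scale (Poly_Mapping.lookup x D) (w D))"

lemma linear_extension_superset:
  assumes "finite K" "Poly_Mapping.keys x \<subseteq> K"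
  shows "linear_extension w x = (\<Sum>D\<in>K. int_scale (Poly_Mapping.lookup x D) (w D))"
  unfolding linear_extension_def
  using assms by (intro sum.mono_neutral_left) (auto simp: in_keys_iff)

lemma linear_extension_add: "linear_extension w (x + y) = linear_extension w x + linear_extension w y"
proof -
  let ?K = "Poly_Mapping.keys x \<union> Poly_Mapping.keys y"
  have "linear_extension w z = (\<Sum>D\<in>?K. int_scale (Poly_Mapping.lookup z D) (w D))"
    if "Poly_Mapping.keys z \<subseteq> ?K" for z
    using that by (intro linear_extension_superset) auto
  moreover have "Poly_Mapping.keys (x + y) \<subseteq> ?K" by (rule keys_add)
  ultimately show ?thesis by (simp add: lookup_add int_scale_add sum.distrib)
qed

lemma linear_extension_cmul: "linear_extension w (frag_cmul m x) = int_scale m (linear_extension w x)"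
proof -
  have "linear_extension w (frag_cmul m x) =
      (\<Sum>D\<in>Poly_Mapping.keys x. int_scale (Poly_Mapping.lookup (frag_cmul m x) D) (w D))"
    by (intro linear_extension_superset keys_cmul) simp
  then show ?thesis by (simp add: linear_extension_def int_scale_sum int_scale_mult)
qed

lemma linear_extension_of [simp]: "linear_extension w (frag_of D) = w D"
  by (simp add: linear_extension_def)

lemma linear_extension_sum:
  "linear_extension w (sum f X) = (\<Sum>x\<in>X. linear_extension w (f x))"
  by (induction X rule: infinite_finite_induct)
    (simp_all add: linear_extension_add, simp_all add: linear_extension_def)

section \<open>The extended invariant and its alternating sums\<close>

lift_definition subdiagram_alternating ::
    "(virtual_diagram \<Rightarrow> 'a::ab_group_add) \<Rightarrow> virtual_diagram \<Rightarrow> 'a"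
  is "\<lambda>F D. alternating (\<lambda>Y. F (abs_virtual_diagram (subdiagram D Y))) (crossings D)"
proof -
  fix F :: "virtual_diagram \<Rightarrow> 'a" and D E assume "diagram_iso D E"
  then obtain f where wf: "well_formed D" "well_formed E"
    and f: "bij_betw f (crossings D) (crossings E)"
      "\<forall>c \<in> crossings D. positive E (f c) = positive D c"
      "strands E = map (map (map_prod f id)) (strands D)"
    unfolding diagram_iso_def by blast
  let ?v = "\<lambda>D Y. F (abs_virtual_diagram (subdiagram D Y))"
  have "alternating (?v E) (crossings E) = (\<Sum>Y \<in> Pow (crossings D).
      if even (card (crossings E - f ` Y)) then ?v E (f ` Y) else - ?v E (f ` Y))"
    unfolding alternating_def by (rule sum.reindex_bij_betw[OF bij_betw_Pow[OF f(1)], symmetric])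
  also have "\<dots> = alternating (?v D) (crossings D)"
    unfolding alternating_def
  proof (rule sum.cong[OF refl])
    fix Y assume Y: "Y \<in> Pow (crossings D)"
    then have "?v E (f ` Y) = ?v D Y"
      using diagram_iso_subdiagram[OF wf f, of Y]
      by (auto intro!: arg_cong[of _ _ F] Quotient_rel_abs[OF Quotient_virtual_diagram, symmetric])
    moreover have "crossings E - f ` Y = f ` (crossings D - Y)"
      using f(1) Y inj_on_image_set_diff[of f "crossings D" "crossings D" Y] by (simp add: bij_betw_def)
    moreover have "inj_on f (crossings D - Y)"
      using f(1) by (auto simp: bij_betw_def inj_on_def)
    ultimately show "(if even (card (crossings E - f ` Y)) then ?v E (f ` Y) else - ?v E (f ` Y)) =
        (if even (card (crossings D - Y)) then ?v D Y else - ?v D Y)"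
      by (simp add: card_image)
  qed
  finally show "alternating (?v D) (crossings D) = alternating (?v E) (crossings E)" by simp
qed

definition braid_value :: "nat \<Rightarrow> (braid \<Rightarrow> 'a) \<Rightarrow> braid bijection \<Rightarrow> 'a" where
  "braid_value k \<nu> g = \<nu> (apply_bijection g (braid_of k []))"

lemma braid_value_evaluate:
  "braid_diagram k w \<Longrightarrow> braid_value k \<nu> (evaluate (braid_generator k) w) = \<nu> (braid_of k w)"
  by (simp add: braid_value_def apply_evaluate_braid_of)

abbreviation combed_braid :: "nat \<Rightarrow> gauss_letter list \<Rightarrow> braid bijection" where
  "combed_braid k \<equiv> braid_relations.combed (braid_generator k) k"

text \<open>For a diagram without a Gauss word on \<open>k\<close> strands the choice is arbitrary;
  subdiagrams of braid diagrams always have one.\<close>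

definition diagram_value :: "nat \<Rightarrow> (braid \<Rightarrow> 'a) \<Rightarrow> virtual_diagram \<Rightarrow> 'a" where
  "diagram_value k \<nu> D = braid_value k \<nu> (combed_braid k (map snd
     (SOME v. \<exists>E. well_formed E \<and> D = abs_virtual_diagram E \<and> represents k v E)))"

text \<open>The choice may hit another representative and another word, but the representatives are
  isomorphic, so \<open>combed_iso\<close> yields the same group element.\<close>

lemma diagram_value_abs:
  assumes "well_formed E" "represents k v E"
  shows "diagram_value k \<nu> (abs_virtual_diagram E) = braid_value k \<nu> (combed_braid k (map snd v))"
proof -
  define v' where "v' = (SOME v. \<exists>E'. well_formed E' \<and>
    abs_virtual_diagram E = abs_virtual_diagram E' \<and> represents k v E')"
  have "\<exists>E'. well_formed E' \<and> abs_virtual_diagram E = abs_virtual_diagram E' \<and> represents k v' E'"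
    unfolding v'_def by (rule someI[of _ v]) (use assms in blast)
  then obtain E' where E': "well_formed E'" "abs_virtual_diagram E = abs_virtual_diagram E'"
    "represents k v' E'" by blast
  have "diagram_iso E' E"
    using Quotient_rel[OF Quotient_virtual_diagram, of E' E] E' assms(1) by (simp add: diagram_iso_refl)
  from braid_relations.combed_iso[OF braid_relations_generator E'(3) assms(2) this]
  show ?thesis by (simp add: diagram_value_def v'_def[symmetric])
qed

lemma alternating_diagram_value_vanishes:
  fixes \<nu> :: "braid \<Rightarrow> 'a::ab_group_add"
  assumes "finite_type k n \<nu>" "represents k v E" "n < card (crossings E)"
  shows "alternating (\<lambda>Y. braid_value k \<nu> (combed_braid k (map snd (filter (\<lambda>x. fst x \<in> Y) v))))
    (crossings E) = 0"
proof -
  let ?L = "combed_word k v"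
  have pure: "pure_positions k (map fst ?L)" by (simp add: pure_positions_combed_word)
  have "braid_diagram k (realize Y ?L)" for Y
  proof -
    have "Suc i < k" if "(i, e) \<in> set (realize Y ?L)" for i e
    proof -
      have "i \<in> set (map fst (realize Y ?L))" using imageI[OF that, of fst] by (simp del: map_fst_realize)
      then show ?thesis using pure unfolding map_fst_realize pure_positions_def by blast
    qed
    then show ?thesis by (auto simp: braid_diagram_def)
  qed
  \<comment> \<open>The empty prefix and the empty set of fixed names are the initial data for
    \<open>alternating_realize_vanishes\<close>.\<close>
  then have "braid_value k \<nu> (combed_braid k (map snd (filter (\<lambda>x. fst x \<in> Y) v))) =
      resolve (\<lambda>u. \<nu> (braid_of k u)) ([] @ singular_of (realize (Y \<union> {}) ?L))" for Y
    by (simp add: resolve_singular_of braid_value_evaluate[symmetric]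
        braid_relations.evaluate_combed_word[OF braid_relations_generator])
  moreover have "finite (crossings E)" using assms(2) by (simp add: represents_def)
  ultimately show ?thesis
    using assms pure alternating_realize_vanishes[of k n "\<lambda>u. \<nu> (braid_of k u)" "[]" ?L "crossings E" "{}"]
    by (simp add: finite_type_def)
qed

theorem mainTheorem3:
  fixes \<nu> :: "braid \<Rightarrow> 'a::ab_group_add" and k n :: nat
  assumes "k \<ge> 1" and "finite_type k n \<nu>"
  shows "\<exists>\<omega> :: (virtual_diagram \<Rightarrow>\<^sub>0 int) \<Rightarrow> 'a.
    int_linear_on (VPT k) \<omega> \<and>
    (\<forall>D \<in> virtual_diagrams k. n < n_crossings D \<longrightarrow> \<omega> (frag_of D) = 0) \<and>
    (\<forall>B. pure_braid_diagram k B \<longrightarrow>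
       \<nu> (braid_of k B) = \<omega> (s_map (frag_of (virtual_of_braid k B))))"
proof -
  \<comment> \<open>The cut-off makes \<open>\<omega>\<close> vanish beyond \<open>n\<close>
    crossings by definition. What remains is that on subdiagrams of braid diagrams it removes only
    terms that are zero anyway.\<close>
  define w where "w D = (if n_crossings D \<le> n then subdiagram_alternating (diagram_value k \<nu>) D else 0)"
    for D
  have "\<nu> (braid_of k B) = linear_extension w (s_map (frag_of (virtual_of_braid k B)))"
    if B: "pure_braid_diagram k B" for B
  proof -
    define E where "E = concrete_of_braid k B"
    define v where "v = map (\<lambda>m. (m, gauss_letter_at B m)) [0..<length B]"
    have diagram: "braid_diagram k B" using B by (simp add: pure_braid_diagram_def)
    have wf: "well_formed E" and rep: "represents k v E"
      unfolding E_def v_def using diagram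
      by (rule well_formed_concrete_of_braid, rule represents_concrete_of_braid)
    have fin: "finite (crossings E)" using wf by (simp add: well_formed_def)
    let ?F = "\<lambda>Y. diagram_value k \<nu> (abs_virtual_diagram (subdiagram E Y))"
    have F: "?F Y = braid_value k \<nu> (combed_braid k (map snd (filter (\<lambda>x. fst x \<in> Y) v)))"
      if "Y \<subseteq> crossings E" for Y
      using diagram_value_abs[OF well_formed_subdiagram[OF wf that] represents_subdiagram[OF rep that]] .
    have w: "w (abs_virtual_diagram (subdiagram E Z)) = alternating ?F Z" if Z: "Z \<subseteq> crossings E" for Z
    proof (cases "card Z \<le> n")
      case True
      have iso: "diagram_iso (subdiagram E Z) (subdiagram E Z)"
        by (intro diagram_iso_refl well_formed_subdiagram wf Z)
      have "subdiagram (subdiagram E Z) Y = subdiagram E Y" if "Y \<subseteq> Z" for Y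
        using that by (auto simp: subdiagram_def intro!: filter_cong)
      then have "alternating (\<lambda>Y. diagram_value k \<nu> (abs_virtual_diagram (subdiagram (subdiagram E Z) Y))) Z =
          alternating ?F Z"
        by (intro alternating_cong) simp
      then show ?thesis
        using True by (simp add: w_def n_crossings.abs_eq[OF iso] subdiagram_alternating.abs_eq[OF iso])
          (simp add: subdiagram_def)
    next
      case False
      have iso: "diagram_iso (subdiagram E Z) (subdiagram E Z)"
        by (intro diagram_iso_refl well_formed_subdiagram wf Z)
      have cr: "crossings (subdiagram E Z) = Z" by (simp add: subdiagram_def)
      \<comment> \<open>The word of \<open>E\<close> is first filtered to \<open>Z\<close>, so that
        the vanishing result applies to the subdiagram with exactly the crossings
        \<open>Z\<close>.\<close>
      have "alternating ?F Z = alternating (\<lambda>Y. braid_value k \<nu> (combed_braid k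
          (map snd (filter (\<lambda>x. fst x \<in> Y) (filter (\<lambda>x. fst x \<in> Z) v))))) Z"
      proof (rule alternating_cong)
        fix Y assume Y: "Y \<subseteq> Z"
        then have "filter (\<lambda>x. fst x \<in> Y) (filter (\<lambda>x. fst x \<in> Z) v) = filter (\<lambda>x. fst x \<in> Y) v"
          by (auto intro!: filter_cong)
        then show "?F Y = braid_value k \<nu> (combed_braid k
            (map snd (filter (\<lambda>x. fst x \<in> Y) (filter (\<lambda>x. fst x \<in> Z) v))))"
          using F Y Z by simp
      qed
      also have "\<dots> = 0"
        using alternating_diagram_value_vanishes[OF assms(2) represents_subdiagram[OF rep Z]] False
        by (simp add: cr)
      finally show ?thesis using False by (simp add: w_def n_crossings.abs_eq[OF iso] cr)
    qed
    have "s_map (frag_of (virtual_of_braid k B)) =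
        (\<Sum>Z \<in> Pow (crossings E). frag_of (abs_virtual_diagram (subdiagram E Z)))"
      by (simp add: s_map_def virtual_of_braid_def E_def[symmetric]
          subdiagram_sum.abs_eq[OF diagram_iso_refl[OF wf]])
    then have "linear_extension w (s_map (frag_of (virtual_of_braid k B))) =
        (\<Sum>Z \<in> Pow (crossings E). alternating ?F Z)"
      by (simp add: linear_extension_sum w)
    \<comment> \<open>Moebius inversion returns the value on the full diagram, which by combing is
      the value of the braid itself.\<close>
    also have "\<dots> = ?F (crossings E)" by (rule sum_alternating[OF fin])
    also have "\<dots> = braid_value k \<nu> (combed_braid k (map snd (filter (\<lambda>x. fst x \<in> crossings E) v)))"
      by (rule F) simp
    also have "filter (\<lambda>x. fst x \<in> crossings E) v = v"
      using rep by (simp add: represents_def)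
    also have "map snd v = gauss_letters B"
      by (simp add: v_def gauss_letters_def comp_def)
    also have "combed_braid k (gauss_letters B) = evaluate (braid_generator k) B"
      using braid_relations.evaluate_pure_braid[OF braid_relations_generator B] by simp
    also have "braid_value k \<nu> \<dots> = \<nu> (braid_of k B)"
      by (rule braid_value_evaluate[OF diagram])
    finally show ?thesis by simp
  qed
  then show ?thesis
    by (intro exI[of _ "linear_extension w"])
      (simp add: int_linear_on_def linear_extension_add linear_extension_cmul w_def)
qed

end
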